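(* For every integer $r\ge2$, asymptotically almost surely, $$t_r(\mathbb{RM}_n)=\Theta\left(n^{r/(2r-1)}\right).$$ That is, for every $r\ge 2$ there are constants $c,C>0$ (depending only on $r$) such that the probability that $c\,n^{r/(2r-1)}\le t_r(\mathbb{RM}_n)\le C\,n^{r/(2r-1)}$ tends to $1$ as $n\to\infty$.
   Context: An ordered matching of size $n$ is a graph on a linearly ordered vertex set of $2n$ vertices consisting of $n$ pairwise vertex-disjoint edges. $\mathbb{RM}_n$ denotes a random ordered matching of size $n$, selected uniformly at random from all $(2n)!/(n!2^n)$ matchings of size $n$ on the vertex set $\{1,\dots,2n\}$ with its natural order. Two ordered graphs on $m$ vertices $v_1<\cdots<v_m$ and $w_1<\cdots<w_m$ are order-isomorphic if for all $i<j$, $v_iv_j$ is an edge of the first if and only if $w_iw_j$ is an edge of the second. For $r\ge2$, $r$-twins in an ordered matching $M$ are $r$ pairwise disjoint, pairwise order-isomorphic sub-matchings $M_1,\dots,M_r$ of $M$ (sub-matchings inherit the vertex order of $M$); their size is the number of edges in just one of them, $|M_1|=\cdots=|M_r|$. $t_r(M)$ denotes the maximum size of $r$-twins in $M$. "Asymptotically almost surely" (a.a.s.) means with probability tending to $1$ as $n\to\infty$. *)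

theory Defs
  imports "HOL-Probability.Probability"
begin

text \<open>A graph is given by its vertex set and its set of edges, an edge being a two-element set
  of vertices.\<close>

definition ordered_matching :: "nat \<Rightarrow> 'a::linorder set \<Rightarrow> 'a set set \<Rightarrow> bool" where
  "ordered_matching n V M \<longleftrightarrow>
     finite V \<and> card V = 2 * n \<and> (\<forall>e\<in>M. e \<subseteq> V \<and> card e = 2) \<and>
     card M = n \<and> pairwise disjnt M"

definition matchings :: "nat \<Rightarrow> nat set set set" where
  "matchings n = {M. ordered_matching n {1..2 * n} M}"

definition random_matching :: "nat \<Rightarrow> nat set set pmf" where
  "random_matching n = pmf_of_set (matchings n)"

text \<open>The \<open>i\<close>-th vertex of \<open>V\<close> in increasing order is \<open>sorted_list_of_set V ! i\<close>, counting
  from \<open>0\<close>.\<close>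

definition order_isomorphic ::
  "'a::linorder set \<Rightarrow> 'a set set \<Rightarrow> 'b::linorder set \<Rightarrow> 'b set set \<Rightarrow> bool" where
  "order_isomorphic V E W F \<longleftrightarrow>
     finite V \<and> finite W \<and> card V = card W \<and>
     (\<forall>i j. i < j \<and> j < card V \<longrightarrow>
        ({sorted_list_of_set V ! i, sorted_list_of_set V ! j} \<in> E \<longleftrightarrow>
         {sorted_list_of_set W ! i, sorted_list_of_set W ! j} \<in> F))"

text \<open>A sub-matching of \<open>M\<close> is a set \<open>T\<close> of edges of \<open>M\<close>; its vertex set is \<open>\<Union>T\<close>, since a
  matching has no isolated vertices. As the edges of \<open>M\<close> are pairwise disjoint, sub-matchings
  without a common edge have no common vertex either. Twins are indexed by \<open>{..<r}\<close>
  rather than collected in a set so that \<open>r\<close> empty sub-matchings count as twins of size \<open>0\<close>.\<close>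

definition twins :: "nat \<Rightarrow> 'a::linorder set set \<Rightarrow> nat \<Rightarrow> (nat \<Rightarrow> 'a set set) \<Rightarrow> bool" where
  "twins r M k T \<longleftrightarrow>
     (\<forall>i<r. T i \<subseteq> M \<and> card (T i) = k) \<and>
     (\<forall>i<r. \<forall>j<r. i \<noteq> j \<longrightarrow>
        T i \<inter> T j = {} \<and> order_isomorphic (\<Union>(T i)) (T i) (\<Union>(T j)) (T j))"

definition max_twins :: "nat \<Rightarrow> 'a::linorder set set \<Rightarrow> nat" where
  "max_twins r M = Max {k. \<exists>T. twins r M k T}"

text \<open>The conditions under which \<open>pmf_of_set\<close> and \<open>Max\<close> above have their intended meaning.\<close>

lemma finite_matchings: "finite (matchings n)"
  by (rule finite_subset[of _ "Pow (Pow {1..2 * n})"])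
     (auto simp: matchings_def ordered_matching_def)

lemma matchings_nonempty: "matchings n \<noteq> {}"
proof -
  define f where "f = (\<lambda>i::nat. {2 * i + 1, 2 * i + 2})"
  have disj: "disjnt (f i) (f j)" if "i \<noteq> j" for i j
    using that unfolding f_def disjnt_def by (auto; presburger)
  have ne: "f i \<noteq> {}" for i
    by (simp add: f_def)
  have inj: "inj_on f {..<n}"
  proof (rule inj_onI, rule ccontr)
    fix i j assume "f i = f j" "i \<noteq> j"
    then show False using disj[of i j] ne[of j] by (simp add: disjnt_def)
  qed
  have "ordered_matching n {1..2 * n} (f ` {..<n})"
    unfolding ordered_matching_def
  proof (intro conjI ballI)
    show "card (f ` {..<n}) = n"
      using inj by (simp add: card_image)
    show "pairwise disjnt (f ` {..<n})"
      using disj unfolding pairwise_def by (metis imageE)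
  qed (auto simp: f_def)
  then show ?thesis
    by (auto simp: matchings_def)
qed

lemma finite_twins_sizes:
  assumes "finite M" "r \<ge> 1"
  shows "finite {k. \<exists>T. twins r M k T}"
proof (rule finite_subset)
  show "{k. \<exists>T. twins r M k T} \<subseteq> {..card M}"
  proof
    fix k assume "k \<in> {k. \<exists>T. twins r M k T}"
    then obtain T where "T 0 \<subseteq> M" "card (T 0) = k"
      using assms(2) by (auto simp: twins_def)
    then show "k \<in> {..card M}"
      using card_mono[OF assms(1)] by auto
  qed
qed simp

lemma twins_empty: "twins r M 0 (\<lambda>_. {})"
  by (simp add: twins_def order_isomorphic_def)

end

theory Submission
  imports Defs
begin

text \<open>Upper bound: \<open>r\<close>-twins of size \<open>k\<close> are determined by the first twin and the vertex sets of the
  others, and a fixed set of \<open>r * k\<close> edges lies in the random matching with probability at most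
  \<open>(e / n) ^ (r * k)\<close>. So such twins exist with probability at most
  \<open>(2 * e ^ (3 * r - 1) * n ^ r / k ^ (2 * r - 1)) ^ k\<close>, which is summable once \<open>k ^ (2 * r - 1)\<close> is a
  large multiple of \<open>n ^ r\<close>.

  Lower bound: write \<open>n = x ^ (2 * r - 1)\<close> and cut the vertices into about \<open>x ^ r\<close> blocks, each
  consisting of \<open>r\<close> parts of about \<open>x ^ (r - 1) / 2\<close> vertices. Link two blocks if for each \<open>i\<close> some edge
  joins their \<open>i\<close>-th parts. Disjoint linked pairs yield twins, the \<open>i\<close>-th twin using the \<open>i\<close>-th parts.
  The expected number of linked pairs that meet no other linked pair has order \<open>x ^ r\<close>. The maximum
  number of disjoint linked pairs changes by at most \<open>2\<close> when two vertices are transposed, so its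
  variance is \<open>O(n)\<close>, which is of smaller order than \<open>x ^ (2 * r)\<close>, and Chebyshev's inequality
  applies.\<close>

subsection \<open>Perfect matchings\<close>

text \<open>Arbitrary vertex sets are allowed because the inductions delete a matched pair, after
  which the vertices need not form an interval.\<close>

abbreviation perfect_matchings :: "nat \<Rightarrow> 'a::linorder set \<Rightarrow> 'a set set set" where
  "perfect_matchings n V \<equiv> {M. ordered_matching n V M}"

text \<open>The double factorial 1 * 3 * ... * (2n - 1) = (2n)! / (n! 2^n).\<close>

definition num_matchings :: "nat \<Rightarrow> nat" where
  "num_matchings n = (\<Prod>i<n. 2 * i + 1)"

lemma num_matchings_pos: "num_matchings n > 0"
  by (simp add: num_matchings_def prod_pos)

lemma num_matchings_Suc: "num_matchings (Suc n) = (2 * n + 1) * num_matchings n"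
  by (simp add: num_matchings_def)

lemma finite_perfect_matchings:
  assumes "finite V"
  shows "finite (perfect_matchings n V)"
  by (rule finite_subset[of _ "Pow (Pow V)"]) (auto simp: ordered_matching_def assms)

lemma ordered_matching_finite: "ordered_matching n V M \<Longrightarrow> finite M"
  unfolding ordered_matching_def by (meson Pow_iff finite_Pow_iff finite_subset subsetI)

lemma card_Union_matching:
  assumes "finite F" "pairwise disjnt F" "\<And>e. e \<in> F \<Longrightarrow> card e = 2"
  shows "card (\<Union>F) = 2 * card F"
proof -
  have "card (\<Union>F) = sum card F"
    by (rule card_Union_disjoint) (use assms in \<open>auto intro: card_ge_0_finite\<close>)
  then show ?thesis using assms(3) by simp
qed

lemma Union_matching_eq:
  assumes "ordered_matching n V M"
  shows "\<Union>M = V"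
proof (rule card_subset_eq)
  show "finite V" "\<Union>M \<subseteq> V"
    using assms by (auto simp: ordered_matching_def)
  show "card (\<Union>M) = card V"
    using card_Union_matching[of M] assms ordered_matching_finite[OF assms]
    by (auto simp: ordered_matching_def)
qed

lemma ordered_matching_Un:
  assumes F: "finite F" "pairwise disjnt F" "\<And>e. e \<in> F \<Longrightarrow> e \<subseteq> V \<and> card e = 2"
    and V: "finite V"
    and M: "ordered_matching n (V - \<Union>F) M"
  shows "ordered_matching (n + card F) V (M \<union> F)" "M \<inter> F = {}"
proof -
  have fM: "finite M" using M by (rule ordered_matching_finite)
  have ne: "e \<noteq> {}" if "e \<in> F" for e using F(3)[OF that] by auto
  have dis: "disjnt e e'" if "e \<in> M" "e' \<in> F" for e e'
    using that M by (force simp: ordered_matching_def disjnt_def)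
  show MF: "M \<inter> F = {}" using dis ne by (fastforce simp: disjnt_def)
  have "card (\<Union>F) \<le> card V" using F(3) V by (intro card_mono) auto
  moreover have "card (V - \<Union>F) = card V - card (\<Union>F)"
    using F(3) V by (intro card_Diff_subset) (auto intro: finite_subset)
  ultimately have "card V = 2 * (n + card F)"
    using M card_Union_matching[OF F(1,2)] F(3) by (auto simp: ordered_matching_def)
  moreover have "pairwise disjnt (M \<union> F)"
    using dis F(2) M unfolding ordered_matching_def pairwise_def
    by (metis Un_iff disjnt_sym)
  ultimately show "ordered_matching (n + card F) V (M \<union> F)"
    using M F(3) V MF fM F(1) by (auto simp: ordered_matching_def card_Un_disjoint)
qed

lemma ordered_matching_Diff:
  assumes M: "ordered_matching n V M" and F: "F \<subseteq> M"
  shows "ordered_matching (n - card F) (V - \<Union>F) (M - F)"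
proof -
  have fM: "finite M" using M by (rule ordered_matching_finite)
  then have fF: "finite F" using F finite_subset by blast
  have sub: "\<Union>F \<subseteq> V" using M F by (auto simp: ordered_matching_def)
  have pw: "pairwise disjnt G" if "G \<subseteq> M" for G
    using M that pairwise_subset by (auto simp: ordered_matching_def)
  have "card (\<Union>F) = 2 * card F"
    using M F fF pw by (intro card_Union_matching) (auto simp: ordered_matching_def)
  moreover have "e \<inter> \<Union>F = {}" if "e \<in> M - F" for e
    using that M F by (fastforce simp: ordered_matching_def pairwise_def disjnt_def)
  moreover have "finite (\<Union>F)" using sub M by (auto simp: ordered_matching_def intro: finite_subset)
  ultimately show ?thesis
    using M F sub fF pw[of "M - F"]
    by (auto simp: ordered_matching_def card_Diff_subset diff_mult_distrib2)
qed

section \<open>Counting matchings with prescribed edges\<close>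

text \<open>Adding the fixed edges \<open>F\<close> to a matching of the uncovered vertices is
  inverse to deleting them, so counting matchings through \<open>F\<close> reduces to a smaller
  vertex set.\<close>

lemma bij_betw_matchings_containing:
  assumes F: "finite F" "pairwise disjnt F" "\<And>e. e \<in> F \<Longrightarrow> e \<subseteq> V \<and> card e = 2"
    and V: "finite V"
  shows "bij_betw (\<lambda>M. M \<union> F) (perfect_matchings n (V - \<Union>F))
           {M \<in> perfect_matchings (n + card F) V. F \<subseteq> M}"
proof (rule bij_betw_byWitness[where f' = "\<lambda>M. M - F"])
  show "(\<lambda>M. M - F) ` {M \<in> perfect_matchings (n + card F) V. F \<subseteq> M} \<subseteq> perfect_matchings n (V - \<Union>F)"
  proof (intro image_subsetI CollectI)
    fix M assume "M \<in> {M \<in> perfect_matchings (n + card F) V. F \<subseteq> M}"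
    then have "ordered_matching (n + card F - card F) (V - \<Union>F) (M - F)"
      by (intro ordered_matching_Diff) auto
    then show "ordered_matching n (V - \<Union>F) (M - F)" by simp
  qed
  show "\<forall>M\<in>perfect_matchings n (V - \<Union>F). M \<union> F - F = M"
    using ordered_matching_Un(2)[OF F V] by blast
qed (use ordered_matching_Un(1)[OF F V] in auto)

lemma perfect_matchings_0: "perfect_matchings 0 {} = {{}}"
  by (auto simp: ordered_matching_def dest: card_ge_0_finite)

text \<open>The edge at \<open>x\<close> has exactly one other endpoint \<open>y\<close>; deleting
  \<open>{x, y}\<close> identifies the class of matchings with this \<open>y\<close> with the
  matchings of the remaining vertices. A general summand \<open>f\<close> serves both the count of
  all matchings and the variance recursion.\<close>

lemma sum_perfect_matchings_Suc:
  fixes f :: "'a::linorder set set \<Rightarrow> 'b::comm_monoid_add"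
  assumes V: "finite V" and x: "x \<in> V"
  shows "(\<Sum>M\<in>perfect_matchings (Suc n) V. f M) =
    (\<Sum>y\<in>V - {x}. \<Sum>M\<in>perfect_matchings n (V - {x, y}). f (insert {x, y} M))"
proof -
  let ?P = "perfect_matchings (Suc n) V"
  have "?P = (\<Union>y\<in>V - {x}. {M \<in> ?P. {x, y} \<in> M})"
  proof (intro equalityI subsetI)
    fix M assume M: "M \<in> ?P"
    then have "x \<in> \<Union>M" using Union_matching_eq x by blast
    then obtain e where e: "e \<in> M" "x \<in> e" by blast
    with M have "card e = 2" "e \<subseteq> V" by (auto simp: ordered_matching_def)
    with e obtain y where "e = {x, y}" "y \<noteq> x" "y \<in> V" by (auto simp: card_2_iff)
    with e M show "M \<in> (\<Union>y\<in>V - {x}. {M \<in> ?P. {x, y} \<in> M})" by blast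
  qed auto
  then have "(\<Sum>M\<in>?P. f M) = (\<Sum>M\<in>(\<Union>y\<in>V - {x}. {M \<in> ?P. {x, y} \<in> M}). f M)"
    by (rule arg_cong)
  also have "\<dots> = (\<Sum>y\<in>V - {x}. \<Sum>M\<in>{M \<in> ?P. {x, y} \<in> M}. f M)"
  proof (rule sum.UNION_disjoint)
    have "y = z" if "{x, y} \<in> M" "{x, z} \<in> M" "ordered_matching (Suc n) V M" for y z M
      using that unfolding ordered_matching_def pairwise_def disjnt_def
      by (metis disjoint_iff doubleton_eq_iff insertI1)
    then show "\<forall>y\<in>V - {x}. \<forall>z\<in>V - {x}. y \<noteq> z \<longrightarrow>
      {M \<in> ?P. {x, y} \<in> M} \<inter> {M \<in> ?P. {x, z} \<in> M} = {}"
      by blast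
  qed (use V finite_perfect_matchings[OF V] in auto)
  also have "\<dots> = (\<Sum>y\<in>V - {x}. \<Sum>M\<in>perfect_matchings n (V - {x, y}). f (insert {x, y} M))"
  proof (rule sum.cong[OF refl])
    fix y assume "y \<in> V - {x}"
    then have "bij_betw (\<lambda>M. M \<union> {{x, y}}) (perfect_matchings n (V - {x, y})) {M \<in> ?P. {x, y} \<in> M}"
      using bij_betw_matchings_containing[of "{{x, y}}" V n] V x by (auto simp: card_insert_if)
    from sum.reindex_bij_betw[OF this, of f]
    show "(\<Sum>M\<in>{M \<in> ?P. {x, y} \<in> M}. f M) = (\<Sum>M\<in>perfect_matchings n (V - {x, y}). f (insert {x, y} M))"
      by simp
  qed
  finally show ?thesis .
qed

lemma card_perfect_matchings:
  fixes V :: "'a::linorder set"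
  assumes "finite V" "card V = 2 * n"
  shows "card (perfect_matchings n V) = num_matchings n"
  using assms
proof (induction n arbitrary: V)
  case 0
  then show ?case by (simp add: perfect_matchings_0 num_matchings_def)
next
  case (Suc n)
  then obtain x where x: "x \<in> V" by fastforce
  have "card (perfect_matchings (Suc n) V) = (\<Sum>M\<in>perfect_matchings (Suc n) V. 1)" by simp
  also have "\<dots> = (\<Sum>y\<in>V - {x}. card (perfect_matchings n (V - {x, y})))"
    by (subst sum_perfect_matchings_Suc[OF Suc.prems(1) x]) simp
  also have "\<dots> = (\<Sum>y\<in>V - {x}. num_matchings n)"
    using Suc.prems x by (intro sum.cong Suc.IH) (auto simp: card_Diff_subset card_insert_if)
  also have "\<dots> = num_matchings (Suc n)"
    using Suc.prems x by (simp add: num_matchings_Suc)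
  finally show ?case .
qed

lemma card_matchings_containing:
  assumes "pairwise disjnt F" "F \<subseteq> {e. e \<subseteq> V \<and> card e = 2}" "finite V" "card V = 2 * n"
  shows "card {M \<in> perfect_matchings n V. F \<subseteq> M} = num_matchings (n - card F)"
proof -
  have fF: "finite F" using assms(2,3) by (auto intro: finite_subset[of F "Pow V"])
  have U: "card (\<Union>F) = 2 * card F" using assms fF by (intro card_Union_matching) auto
  have sub: "\<Union>F \<subseteq> V" using assms(2) by auto
  then have "card (\<Union>F) \<le> card V" using assms(3) by (intro card_mono) auto
  then have le: "n - card F + card F = n" using U assms(4) by simp
  have "card (V - \<Union>F) = 2 * (n - card F)"
    using U assms(3,4) sub by (simp add: card_Diff_subset finite_subset diff_mult_distrib2)
  then have "card (perfect_matchings (n - card F) (V - \<Union>F)) = num_matchings (n - card F)"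
    using assms(3) by (intro card_perfect_matchings) auto
  moreover have "bij_betw (\<lambda>M. M \<union> F) (perfect_matchings (n - card F) (V - \<Union>F))
           {M \<in> perfect_matchings n V. F \<subseteq> M}"
    using bij_betw_matchings_containing[of F V "n - card F"] fF assms le by auto
  ultimately show ?thesis using bij_betw_same_card by fastforce
qed

text \<open>If \<open>F\<close> consists of disjoint edges inside \<open>V\<close>, the exact count
  applies; otherwise no matching contains \<open>F\<close>. This form suits union bounds over
  candidate edge sets that may fail to be matchings.\<close>

lemma card_matchings_containing_le:
  assumes "finite V" "card V = 2 * n"
  shows "card {M \<in> perfect_matchings n V. F \<subseteq> M} \<le> num_matchings (n - card F)"
proof (cases "pairwise disjnt F \<and> F \<subseteq> {e. e \<subseteq> V \<and> card e = 2}")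
  case True
  then show ?thesis using card_matchings_containing[of F V n] assms by simp
next
  case False
  have "pairwise disjnt F \<and> F \<subseteq> {e. e \<subseteq> V \<and> card e = 2}"
    if "F \<subseteq> M" "ordered_matching n V M" for M
    using that pairwise_subset[of disjnt M F] by (auto simp: ordered_matching_def)
  with False have "{M \<in> perfect_matchings n V. F \<subseteq> M} = {}" by blast
  then show ?thesis by (simp only: card.empty)
qed

subsection \<open>Concentration\<close>

abbreviation swap_vertices :: "'a \<Rightarrow> 'a \<Rightarrow> 'a set set \<Rightarrow> 'a set set" where
  "swap_vertices a b \<equiv> (`) ((`) (Transposition.transpose a b))"

lemma swap_vertices_swap_vertices [simp]: "swap_vertices a b (swap_vertices a b M) = M"
  by (simp add: image_image image_comp)

lemma ordered_matching_image:
  assumes "bij_betw g V W" "finite W" "ordered_matching n V M"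
  shows "ordered_matching n W ((`) ((`) g) M)"
proof -
  have inj: "inj_on g V" "g ` V = W" using assms(1) by (auto simp: bij_betw_def)
  have sub: "e \<subseteq> V" "card e = 2" if "e \<in> M" for e
    using that assms(3) by (auto simp: ordered_matching_def)
  have "inj_on ((`) g) M"
    using inj_on_image_Pow[OF inj(1)] sub by (auto intro: inj_on_subset)
  then have "card ((`) g ` M) = n"
    using assms(3) by (simp add: card_image ordered_matching_def)
  moreover have "card (g ` e) = 2" "g ` e \<subseteq> W" if "e \<in> M" for e
    using sub[OF that] inj by (auto simp: card_image inj_on_subset)
  moreover have "disjnt (g ` e) (g ` e')" if "e \<in> M" "e' \<in> M" "e \<noteq> e'" for e e'
    using that assms(3) inj_on_image_Int[OF inj(1) sub(1)[OF that(1)] sub(1)[OF that(2)]]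
    by (auto simp: ordered_matching_def pairwise_def disjnt_def)
  moreover have "card W = 2 * n"
    using assms(3) bij_betw_same_card[OF assms(1)] by (simp add: ordered_matching_def)
  ultimately show ?thesis
    using assms(2) unfolding ordered_matching_def pairwise_def by blast
qed

text \<open>The vertex sets may differ: the variance recursion compares the completions left after
  pairing \<open>x\<close> with \<open>y\<close> to those left after pairing \<open>x\<close> with
  \<open>z\<close>.\<close>

lemma bij_betw_swap_vertices:
  assumes "finite V" "Transposition.transpose a b ` V = W"
  shows "bij_betw (swap_vertices a b) (perfect_matchings n V) (perfect_matchings n W)"
proof (rule bij_betw_byWitness[where f' = "swap_vertices a b"])
  have VW: "Transposition.transpose a b ` W = V"
    using assms(2) by (auto simp: image_comp)
  have b1: "bij_betw (Transposition.transpose a b) V W" "bij_betw (Transposition.transpose a b) W V"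
    using assms(2) VW by (auto simp: bij_betw_def)
  have "finite W" using assms by blast
  then show "swap_vertices a b ` perfect_matchings n V \<subseteq> perfect_matchings n W"
    using ordered_matching_image[OF b1(1)] by auto
  show "swap_vertices a b ` perfect_matchings n W \<subseteq> perfect_matchings n V"
    using ordered_matching_image[OF b1(2)] assms(1) by auto
qed auto

text \<open>Exposing the partner \<open>y\<close> of one vertex splits the sum of squared deviations into the sums
  for the smaller matchings and the sum of the squared deviations of the conditional means;
  transposing \<open>y\<close> and \<open>z\<close> shows that any two of these means differ by at most \<open>L\<close>.\<close>

lemma matchings_variance_bound:
  fixes f :: "'a::linorder set set \<Rightarrow> real" and L :: real
  assumes "finite V" "card V = 2 * n" "L \<ge> 0"
    and "\<And>M a b. M \<in> perfect_matchings n V \<Longrightarrow> a \<in> V \<Longrightarrow> b \<in> V \<Longrightarrow>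
           \<bar>f (swap_vertices a b M) - f M\<bar> \<le> L"
  shows "(\<Sum>M\<in>perfect_matchings n V.
            (f M - (\<Sum>M\<in>perfect_matchings n V. f M) / num_matchings n)\<^sup>2)
          \<le> n * L\<^sup>2 * num_matchings n"
  using assms
proof (induction n arbitrary: V f)
  case 0
  then show ?case by (simp add: perfect_matchings_0 num_matchings_def)
next
  case (Suc n)
  from Suc.prems obtain x where x: "x \<in> V" by fastforce
  define m where "m = real (num_matchings n)"
  have m: "m > 0" using num_matchings_pos by (simp add: m_def)
  define P where "P y = perfect_matchings n (V - {x, y})" for y
  define g where "g y M = f (insert {x, y} M)" for y M
  define \<mu> where "\<mu> y = (\<Sum>M\<in>P y. g y M) / m" for y
  define \<nu> where "\<nu> = (\<Sum>M\<in>perfect_matchings (Suc n) V. f M) / num_matchings (Suc n)"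
  have cV: "card (V - {x}) = 2 * n + 1" using Suc.prems x by simp
  have cP: "real (card (P y)) = m" if "y \<in> V - {x}" for y
    unfolding P_def m_def using that x Suc.prems
    by (subst card_perfect_matchings) (auto simp: card_Diff_subset card_insert_if)
  have sumg: "(\<Sum>M\<in>P y. g y M) = m * \<mu> y" for y using m by (simp add: \<mu>_def)
  have PM: "insert {x, y} M \<in> perfect_matchings (Suc n) V" if "M \<in> P y" "y \<in> V - {x}" for M y
    using ordered_matching_Un(1)[of "{{x, y}}" V n M] that x Suc.prems(1)
    by (auto simp: P_def card_insert_if)
  have IH: "(\<Sum>M\<in>P y. (g y M - \<mu> y)\<^sup>2) \<le> n * L\<^sup>2 * m" if y: "y \<in> V - {x}" for y
    unfolding P_def \<mu>_def m_def
  proof (rule Suc.IH)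
    show "card (V - {x, y}) = 2 * n"
      using y x Suc.prems by (auto simp: card_Diff_subset card_insert_if)
    \<comment> \<open>Transposing two vertices outside \<open>{x, y}\<close> fixes that edge, so
      \<open>g y\<close> inherits the bound \<open>L\<close> from \<open>f\<close>.\<close>
    fix M a b assume M: "M \<in> perfect_matchings n (V - {x, y})" and ab: "a \<in> V - {x, y}" "b \<in> V - {x, y}"
    then have "Transposition.transpose a b ` {x, y} = {x, y}"
      by (auto simp: Transposition.transpose_def)
    then have "swap_vertices a b (insert {x, y} M) = insert {x, y} (swap_vertices a b M)" by simp
    then show "\<bar>g y (swap_vertices a b M) - g y M\<bar> \<le> L"
      unfolding g_def using Suc.prems(4)[OF PM[of M y], of a b] M ab y by (simp add: P_def)
  qed (use Suc.prems in auto)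
  have diff: "\<bar>\<mu> y - \<mu> z\<bar> \<le> L" if y: "y \<in> V - {x}" and z: "z \<in> V - {x}" for y z
  proof -
    have "Transposition.transpose y z ` (V - {x, y}) = V - {x, z}"
    proof -
      have "Transposition.transpose y z ` V = V" using y z by simp
      then have "Transposition.transpose y z ` (V - {x, y}) = V - Transposition.transpose y z ` {x, y}"
        by (metis image_set_diff inj_on_transpose)
      also have "Transposition.transpose y z ` {x, y} = {x, z}"
        using y z by (auto simp: Transposition.transpose_def)
      finally show ?thesis .
    qed
    then have bij: "bij_betw (swap_vertices y z) (P y) (P z)"
      unfolding P_def using Suc.prems by (intro bij_betw_swap_vertices) auto
    have "m * (\<mu> z - \<mu> y) = (\<Sum>M\<in>P y. g z (swap_vertices y z M) - g y M)"
      using sum.reindex_bij_betw[OF bij, of "g z"] sumg[of y] sumg[of z]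
      by (simp add: sum_subtractf algebra_simps)
    also have "\<bar>\<dots>\<bar> \<le> (\<Sum>M\<in>P y. L)"
    proof (intro order_trans[OF sum_abs] sum_mono)
      fix M assume M: "M \<in> P y"
      have "Transposition.transpose y z ` {x, y} = {x, z}"
        using y z by (auto simp: Transposition.transpose_def)
      then have "swap_vertices y z (insert {x, y} M) = insert {x, z} (swap_vertices y z M)" by simp
      then show "\<bar>g z (swap_vertices y z M) - g y M\<bar> \<le> L"
        unfolding g_def using Suc.prems(4)[OF PM[OF M y], of y z] y z by simp
    qed
    also have "\<dots> = m * L" using cP[OF y] by simp
    finally have "m * \<bar>\<mu> z - \<mu> y\<bar> \<le> m * L" using m by (simp add: abs_mult)
    then show ?thesis using m by (simp add: abs_minus_commute)
  qed
  have \<nu>: "(2 * n + 1) * \<nu> = (\<Sum>y\<in>V - {x}. \<mu> y)"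
  proof -
    have "(\<Sum>y\<in>V - {x}. \<mu> y) = (\<Sum>M\<in>perfect_matchings (Suc n) V. f M) / m"
      unfolding \<mu>_def g_def P_def
      by (subst sum_perfect_matchings_Suc[OF Suc.prems(1) x]) (simp add: sum_divide_distrib)
    moreover have "real (num_matchings (Suc n)) = (2 * n + 1) * m"
      by (simp add: num_matchings_Suc m_def algebra_simps)
    ultimately show ?thesis using m by (simp add: \<nu>_def divide_simps)
  qed
  \<comment> \<open>The overall mean is the average of the 2n + 1 conditional means, any two of
    which differ by at most \<open>L\<close>.\<close>
  have dev: "(\<mu> y - \<nu>)\<^sup>2 \<le> L\<^sup>2" if y: "y \<in> V - {x}" for y
  proof -
    have "(2 * n + 1) * (\<mu> y - \<nu>) = (\<Sum>z\<in>V - {x}. \<mu> y - \<mu> z)"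
      using \<nu> cV by (simp add: sum_subtractf algebra_simps)
    also have "\<bar>\<dots>\<bar> \<le> (\<Sum>z\<in>V - {x}. L)"
      using diff[OF y] by (intro order_trans[OF sum_abs] sum_mono)
    also have "\<dots> = (2 * n + 1) * L" using cV by simp
    finally have "(2 * n + 1) * \<bar>\<mu> y - \<nu>\<bar> \<le> (2 * n + 1) * L"
      by (simp add: abs_mult)
    then have "\<bar>\<mu> y - \<nu>\<bar> \<le> L"
      by (subst (asm) mult_le_cancel_left_pos) auto
    then show ?thesis using Suc.prems(3) by (simp add: abs_le_square_iff[symmetric])
  qed
  have "(\<Sum>M\<in>perfect_matchings (Suc n) V. (f M - \<nu>)\<^sup>2) = (\<Sum>y\<in>V - {x}. \<Sum>M\<in>P y. (g y M - \<nu>)\<^sup>2)"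
    unfolding P_def g_def by (rule sum_perfect_matchings_Suc[OF Suc.prems(1) x])
  also have "\<dots> \<le> (\<Sum>y\<in>V - {x}. Suc n * L\<^sup>2 * m)"
  proof (rule sum_mono)
    fix y assume y: "y \<in> V - {x}"
    \<comment> \<open>The deviation from the overall mean is split at the conditional mean; the
      cross term vanishes when summed over a class.\<close>
    have "(g y M - \<nu>)\<^sup>2 = (g y M - \<mu> y)\<^sup>2 + 2 * (\<mu> y - \<nu>) * (g y M - \<mu> y) + (\<mu> y - \<nu>)\<^sup>2" for M
      by (simp add: power2_eq_square algebra_simps)
    then have "(\<Sum>M\<in>P y. (g y M - \<nu>)\<^sup>2) = (\<Sum>M\<in>P y. (g y M - \<mu> y)\<^sup>2)
        + 2 * (\<mu> y - \<nu>) * (\<Sum>M\<in>P y. g y M - \<mu> y) + card (P y) * (\<mu> y - \<nu>)\<^sup>2"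
      by (simp add: sum.distrib sum_distrib_left)
    also have "(\<Sum>M\<in>P y. g y M - \<mu> y) = 0"
      using sumg[of y] cP[OF y] by (simp add: sum_subtractf)
    also have "(\<Sum>M\<in>P y. (g y M - \<mu> y)\<^sup>2) + 2 * (\<mu> y - \<nu>) * 0 + card (P y) * (\<mu> y - \<nu>)\<^sup>2
        \<le> n * L\<^sup>2 * m + m * L\<^sup>2"
      using IH[OF y] dev[OF y] m cP[OF y] by (auto intro!: add_mono mult_left_mono)
    also have "\<dots> = Suc n * L\<^sup>2 * m" by (simp add: algebra_simps)
    finally show "(\<Sum>M\<in>P y. (g y M - \<nu>)\<^sup>2) \<le> Suc n * L\<^sup>2 * m" .
  qed
  also have "\<dots> = Suc n * L\<^sup>2 * num_matchings (Suc n)"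
    using cV by (simp add: num_matchings_Suc m_def algebra_simps)
  finally show ?case unfolding \<nu>_def .
qed

text \<open>Chebyshev's inequality in counting form: the mean is at least \<open>E\<close>, so a
  value below \<open>E / 2\<close> deviates from it by at least \<open>E / 2\<close>.\<close>

lemma matchings_lower_tail:
  fixes f :: "'a::linorder set set \<Rightarrow> real" and L E :: real
  assumes "finite V" "card V = 2 * n" "L \<ge> 0"
    and "\<And>M a b. M \<in> perfect_matchings n V \<Longrightarrow> a \<in> V \<Longrightarrow> b \<in> V \<Longrightarrow>
           \<bar>f (swap_vertices a b M) - f M\<bar> \<le> L"
    and "E > 0" and E: "(\<Sum>M\<in>perfect_matchings n V. f M) \<ge> E * num_matchings n"
  shows "card {M \<in> perfect_matchings n V. f M < E / 2} \<le> 4 * n * L\<^sup>2 / E\<^sup>2 * num_matchings n"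
proof -
  let ?P = "perfect_matchings n V" and ?m = "real (num_matchings n)"
  define \<nu> where "\<nu> = (\<Sum>M\<in>?P. f M) / ?m"
  have "?m > 0" using num_matchings_pos by simp
  then have \<nu>: "\<nu> \<ge> E" using E by (simp add: \<nu>_def field_simps)
  have "card {M \<in> ?P. f M < E / 2} * (E / 2)\<^sup>2 = (\<Sum>M\<in>{M \<in> ?P. f M < E / 2}. (E / 2)\<^sup>2)" by simp
  also have "\<dots> \<le> (\<Sum>M\<in>{M \<in> ?P. f M < E / 2}. (f M - \<nu>)\<^sup>2)"
  proof (rule sum_mono)
    fix M assume "M \<in> {M \<in> ?P. f M < E / 2}"
    then have "E / 2 \<le> \<nu> - f M" using \<nu> by auto
    then have "(E / 2)\<^sup>2 \<le> (\<nu> - f M)\<^sup>2" using \<open>E > 0\<close> by (intro power_mono) auto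
    then show "(E / 2)\<^sup>2 \<le> (f M - \<nu>)\<^sup>2" by (simp add: power2_commute)
  qed
  also have "\<dots> \<le> (\<Sum>M\<in>?P. (f M - \<nu>)\<^sup>2)"
    using finite_perfect_matchings[OF assms(1)] by (intro sum_mono2) auto
  also have "\<dots> \<le> n * L\<^sup>2 * ?m"
    unfolding \<nu>_def by (rule matchings_variance_bound) (use assms in auto)
  finally show ?thesis using \<open>E > 0\<close> by (simp add: field_simps)
qed

subsection \<open>The first moment bound\<close>

text \<open>The edges of \<open>E\<close> are transported to \<open>W\<close> by rank. A twin of
  \<open>E\<close> with vertex set \<open>W\<close> must be this edge set, so it can be encoded by
  \<open>W\<close> alone.\<close>

definition order_copy :: "'a::linorder set set \<Rightarrow> 'b::linorder set \<Rightarrow> 'b set set" where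
  "order_copy E W = {{sorted_list_of_set W ! i, sorted_list_of_set W ! j} | i j.
     i < j \<and> j < card W \<and> {sorted_list_of_set (\<Union>E) ! i, sorted_list_of_set (\<Union>E) ! j} \<in> E}"

text \<open>Order isomorphism prescribes which pairs of positions are edges, and since every edge of
  \<open>F\<close> has two elements, these pairs determine \<open>F\<close>.\<close>

lemma order_isomorphic_imp_order_copy:
  assumes iso: "order_isomorphic (\<Union>E) E (\<Union>F) F" and F: "\<And>f. f \<in> F \<Longrightarrow> card f = 2"
  shows "order_copy E (\<Union>F) = F"
proof
  have c: "card (\<Union>E) = card (\<Union>F)" and fin: "finite (\<Union>F)"
    using iso by (auto simp: order_isomorphic_def)
  have iff: "{sorted_list_of_set (\<Union>E) ! i, sorted_list_of_set (\<Union>E) ! j} \<in> E \<longleftrightarrow>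
       {sorted_list_of_set (\<Union>F) ! i, sorted_list_of_set (\<Union>F) ! j} \<in> F"
    if "i < j" "j < card (\<Union>F)" for i j
    using iso that unfolding order_isomorphic_def by metis
  show "order_copy E (\<Union>F) \<subseteq> F"
    using iff by (auto simp: order_copy_def)
  show "F \<subseteq> order_copy E (\<Union>F)"
  proof
    fix f assume f: "f \<in> F"
    then obtain a b where ab: "f = {a, b}" "a \<noteq> b" using F[OF f] by (auto simp: card_2_iff)
    have "\<exists>i<card (\<Union>F). sorted_list_of_set (\<Union>F) ! i = v" if "v \<in> f" for v
      using that f fin by (metis UnionI in_set_conv_nth length_sorted_list_of_set set_sorted_list_of_set)
    then obtain i j where i: "i < card (\<Union>F)" "sorted_list_of_set (\<Union>F) ! i = a"
      and j: "j < card (\<Union>F)" "sorted_list_of_set (\<Union>F) ! j = b"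
      using ab by blast
    then have "i \<noteq> j" using ab by auto
    \<comment> \<open>Order isomorphism speaks only of increasing positions, so an edge whose
      endpoints come in reverse order is first turned round.\<close>
    then consider "i < j" | "j < i" by linarith
    then show "f \<in> order_copy E (\<Union>F)"
    proof cases
      case 1
      then show ?thesis using iff[of i j] i j f ab unfolding order_copy_def by blast
    next
      case 2
      then have "{sorted_list_of_set (\<Union>E) ! j, sorted_list_of_set (\<Union>E) ! i} \<in> E"
        using iff[of j i] i j f ab by (simp add: insert_commute)
      moreover have "f = {sorted_list_of_set (\<Union>F) ! j, sorted_list_of_set (\<Union>F) ! i}"
        using i j ab by auto
      ultimately show ?thesis using 2 i c unfolding order_copy_def by blast
    qed
  qed
qed

lemma card_Union_twins:
  assumes "twins r M k T" "finite M"
  shows "card (\<Union>j<r. T j) = r * k" "(\<Union>j<r. T j) \<subseteq> M"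
proof -
  have "card (\<Union>j<r. T j) = (\<Sum>j<r. card (T j))"
    using assms by (intro card_UN_disjoint) (auto simp: twins_def intro: finite_subset)
  then show "card (\<Union>j<r. T j) = r * k" using assms by (simp add: twins_def)
qed (use assms in \<open>auto simp: twins_def\<close>)

text \<open>Union bound over codes: \<open>x\<close> in \<open>I\<close> holds a candidate first
  twin and the vertex sets of the other \<open>r - 1\<close> twins, and \<open>G x\<close> decodes
  it into the union of all twins.\<close>

lemma card_matchings_with_twins_le:
  assumes V: "finite V" "card V = 2 * n" and r: "r \<ge> 1"
  shows "card {M \<in> perfect_matchings n V. \<exists>T. twins r M k T}
     \<le> (((2 * n) choose 2) choose k) * ((2 * n) choose (2 * k)) ^ (r - 1) * num_matchings (n - r * k)"
proof -
  define EV where "EV = {e. e \<subseteq> V \<and> card e = 2}"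
  define I where "I = {E. E \<subseteq> EV \<and> card E = k} \<times>
      (\<Pi>\<^sub>E j\<in>{1..<r}. {W. W \<subseteq> V \<and> card W = 2 * k})"
  define G where "G x = fst x \<union> (\<Union>j\<in>{1..<r}. order_copy (fst x) (snd x j))" for x :: "'a set set \<times> (nat \<Rightarrow> 'a set)"
  have fEV: "finite EV" using V by (auto simp: EV_def)
  have cEV: "card EV = (2 * n) choose 2" using n_subsets[OF V(1)] V(2) by (simp add: EV_def)
  have finI: "finite I" unfolding I_def using V fEV
    by (intro finite_cartesian_product finite_PiE) auto
  have cI: "card I = (((2 * n) choose 2) choose k) * ((2 * n) choose (2 * k)) ^ (r - 1)"
    unfolding I_def using n_subsets[OF fEV] n_subsets[OF V(1)] V(2) cEV
    by (simp add: card_cartesian_product card_PiE)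
  \<comment> \<open>Only codes that decode to \<open>r * k\<close> edges are kept. Twins are
    disjoint, so none is lost, and every kept code obeys the same bound on the number of matchings
    containing its edges.\<close>
  have "{M \<in> perfect_matchings n V. \<exists>T. twins r M k T}
     \<subseteq> (\<Union>x\<in>{x \<in> I. card (G x) = r * k}. {M \<in> perfect_matchings n V. G x \<subseteq> M})"
  proof
    fix M assume "M \<in> {M \<in> perfect_matchings n V. \<exists>T. twins r M k T}"
    then obtain T where M: "ordered_matching n V M" and T: "twins r M k T" by auto
    have fM: "finite M" using ordered_matching_finite[OF M] .
    have TM: "T j \<subseteq> M" "card (T j) = k" if "j < r" for j using T that by (auto simp: twins_def)
    define x where "x = (T 0, restrict (\<lambda>j. \<Union>(T j)) {1..<r})"
    have cU: "card (\<Union>(T j)) = 2 * k" "\<Union>(T j) \<subseteq> V" if "j < r" for j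
    proof -
      show "card (\<Union>(T j)) = 2 * k"
        using card_Union_matching[of "T j"] TM[OF that] fM M pairwise_subset[of disjnt M "T j"]
        by (auto simp: ordered_matching_def intro: finite_subset)
      show "\<Union>(T j) \<subseteq> V" using TM[OF that] M by (auto simp: ordered_matching_def)
    qed
    have "T 0 \<subseteq> EV" using TM[of 0] r M by (auto simp: EV_def ordered_matching_def)
    then have xI: "x \<in> I" using cU TM[of 0] r by (auto simp: x_def I_def)
    have "order_copy (T 0) (\<Union>(T j)) = T j" if "j \<in> {1..<r}" for j
    proof (rule order_isomorphic_imp_order_copy)
      have "\<forall>i<r. \<forall>j<r. i \<noteq> j \<longrightarrow> order_isomorphic (\<Union>(T i)) (T i) (\<Union>(T j)) (T j)"
        using T by (auto simp: twins_def)
      then show "order_isomorphic (\<Union>(T 0)) (T 0) (\<Union>(T j)) (T j)" using that r by auto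
      show "card f = 2" if "f \<in> T j" for f
        using that TM[of j] \<open>j \<in> {1..<r}\<close> M by (auto simp: ordered_matching_def)
    qed
    then have "G x = T 0 \<union> (\<Union>j\<in>{1..<r}. T j)" by (simp add: G_def x_def)
    also have "\<dots> = (\<Union>j\<in>insert 0 {1..<r}. T j)" by simp
    also have "insert 0 {1..<r} = {..<r}" using r by auto
    finally have "G x = (\<Union>j<r. T j)" .
    then show "M \<in> (\<Union>x\<in>{x \<in> I. card (G x) = r * k}. {M \<in> perfect_matchings n V. G x \<subseteq> M})"
      using card_Union_twins[OF T fM] xI M by (intro UN_I[of x]) auto
  qed
  then have "card {M \<in> perfect_matchings n V. \<exists>T. twins r M k T}
     \<le> card (\<Union>x\<in>{x \<in> I. card (G x) = r * k}. {M \<in> perfect_matchings n V. G x \<subseteq> M})"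
    using finI finite_perfect_matchings[OF V(1)] by (intro card_mono) auto
  also have "\<dots> \<le> (\<Sum>x\<in>{x \<in> I. card (G x) = r * k}. card {M \<in> perfect_matchings n V. G x \<subseteq> M})"
    using finI by (intro card_UN_le) auto
  also have "\<dots> \<le> (\<Sum>x\<in>{x \<in> I. card (G x) = r * k}. num_matchings (n - r * k))"
  proof (rule sum_mono)
    fix x assume "x \<in> {x \<in> I. card (G x) = r * k}"
    then show "card {M \<in> perfect_matchings n V. G x \<subseteq> M} \<le> num_matchings (n - r * k)"
      using card_matchings_containing_le[OF V, of "G x"] by simp
  qed
  also have "\<dots> \<le> card I * num_matchings (n - r * k)"
    using finI by (auto intro!: mult_right_mono card_mono)
  finally show ?thesis unfolding cI .
qed

section \<open>Exponential estimates for the first moment\<close>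

text \<open>The quotient s^s / s! is a single term of the exponential series for e^s.\<close>

lemma power_self_le_exp_fact: "real s ^ s \<le> exp 1 ^ s * fact s"
proof -
  have "real s ^ s /\<^sub>R fact s \<le> (\<Sum>n. real s ^ n /\<^sub>R fact n)"
    using sum_le_suminf[of "\<lambda>n. real s ^ n /\<^sub>R fact n" "{s}"] summable_exp_generic[of "real s"] by simp
  also have "\<dots> = exp 1 ^ s"
    using exp_of_nat_mult[of s "1 :: real"] by (simp add: exp_def)
  finally show ?thesis by (simp add: field_simps)
qed

lemma binomial_le_exp_power:
  assumes "k > 0"
  shows "real (a choose k) \<le> (exp 1 * real a / real k) ^ k"
proof -
  have "real (a choose k) * real k ^ k \<le> real (a choose k) * (exp 1 ^ k * fact k)"
    by (intro mult_left_mono power_self_le_exp_fact) auto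
  also have "\<dots> = exp 1 ^ k * real ((a choose k) * fact k)" by simp
  also have "\<dots> \<le> exp 1 ^ k * real (a ^ k)"
    using binomial_fact_pow[of a k] by (intro mult_left_mono of_nat_mono) auto
  finally show ?thesis using assms by (simp add: power_divide power_mult_distrib field_simps)
qed

text \<open>Passing from \<open>n\<close> to \<open>n - s\<close> drops the factors 2(n - i) - 1
  with \<open>i < s\<close>, each at least \<open>n - i\<close>.\<close>

lemma num_matchings_diff_le_prod:
  "s \<le> n \<Longrightarrow> num_matchings (n - s) * (\<Prod>i<s. n - i) \<le> num_matchings n"
proof (induction s)
  case (Suc s)
  then have "num_matchings (n - s) = (2 * (n - Suc s) + 1) * num_matchings (n - Suc s)"
    using num_matchings_Suc[of "n - Suc s"] by (simp add: Suc_diff_Suc)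
  moreover have "n - s \<le> 2 * (n - Suc s) + 1" using Suc.prems by auto
  ultimately have "num_matchings (n - Suc s) * (n - s) \<le> num_matchings (n - s)"
    by (metis mult.commute mult_le_mono1)
  then have "num_matchings (n - Suc s) * (n - s) * (\<Prod>i<s. n - i) \<le> num_matchings (n - s) * (\<Prod>i<s. n - i)"
    by (rule mult_le_mono1)
  also have "\<dots> \<le> num_matchings n" using Suc by auto
  finally show ?case by (simp add: mult_ac)
qed simp

text \<open>As n(s - i) \<le> s(n - i) for s \<le> n, the product of the \<open>n - i\<close> is at
  least n^s s! / s^s, hence at least (n / e)^s. This stays valid when \<open>s\<close> is comparable
  to \<open>n\<close>.\<close>

lemma num_matchings_diff_le:
  assumes "s \<le> n" "n > 0"
  shows "real (num_matchings (n - s)) \<le> (exp 1 / n) ^ s * num_matchings n"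
proof -
  have "n ^ s * fact s = (\<Prod>i<s. n * (s - i))"
    by (simp add: prod.distrib fact_prod_rev atLeast0LessThan)
  also have "\<dots> \<le> (\<Prod>i<s. s * (n - i))"
    using assms by (intro prod_mono) (auto simp: diff_mult_distrib2 mult.commute intro: diff_le_mono2)
  also have "\<dots> = s ^ s * (\<Prod>i<s. n - i)" by (simp add: prod.distrib)
  finally have "num_matchings (n - s) * (n ^ s * fact s)
      \<le> num_matchings (n - s) * (s ^ s * (\<Prod>i<s. n - i))" by (rule mult_le_mono2)
  also have "\<dots> \<le> s ^ s * num_matchings n"
    using num_matchings_diff_le_prod[OF assms(1)] by (simp add: mult_ac)
  finally have "real (num_matchings (n - s) * (n ^ s * fact s)) \<le> real (s ^ s * num_matchings n)"
    by (rule of_nat_mono)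
  then have "real (num_matchings (n - s)) * real n ^ s * fact s \<le> real s ^ s * num_matchings n"
    by (simp add: mult_ac)
  also have "\<dots> \<le> (exp 1 ^ s * fact s) * num_matchings n"
    by (intro mult_right_mono power_self_le_exp_fact) auto
  finally have "real (num_matchings (n - s)) * real n ^ s \<le> exp 1 ^ s * num_matchings n"
    by (simp add: mult_ac)
  then show ?thesis using assms(2) by (simp add: power_divide field_simps)
qed

text \<open>Per unit of \<open>k\<close>, the first twin contributes 2 e n^2 / k, each of the other
  \<open>r - 1\<close> vertex sets (e n / k)^2, and containment of the \<open>r * k\<close> edges (e
  / n)^r. Collecting powers gives the exponents 3r - 1 of e, r of n and 2r - 1 of k. If
  \<open>r * k\<close> exceeds \<open>n\<close>, there are too few edges for twins.\<close>

lemma card_matchings_with_twins_le_power: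
  assumes V: "finite V" "card V = 2 * n" and r: "r \<ge> 1" and k: "k > 0"
  shows "card {M \<in> perfect_matchings n V. \<exists>T. twins r M k T}
     \<le> (2 * exp 1 ^ (3 * r - 1) * real n ^ r / real k ^ (2 * r - 1)) ^ k * num_matchings n"
proof (cases "r * k \<le> n")
  case False
  have "\<not> twins r M k T" if "ordered_matching n V M" for M T
    using card_Union_twins[of r M k T] card_mono[OF ordered_matching_finite[OF that]] that False
    by (metis ordered_matching_def ordered_matching_finite)
  then have "{M \<in> perfect_matchings n V. \<exists>T. twins r M k T} = {}" by auto
  then show ?thesis by (simp only: card.empty) simp
next
  case True
  have n: "n > 0" using True r k by (metis gr0I le_zero_eq mult_eq_0_iff not_one_le_zero)
  obtain q where q: "r = Suc q" using r by (cases r) auto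
  define e where "e = exp (1::real)"
  have e: "e > 0" by (simp add: e_def)
  have "2 * ((2 * n) choose 2) \<le> 4 * n ^ 2"
    by (simp add: choose_two power2_eq_square)
  then have c2: "real ((2 * n) choose 2) \<le> 2 * real n ^ 2"
    using of_nat_mono[of "2 * ((2 * n) choose 2)" "4 * n ^ 2", where 'a = real] by simp
  have "real (((2 * n) choose 2) choose k) \<le> (e * real ((2 * n) choose 2) / real k) ^ k"
    unfolding e_def by (rule binomial_le_exp_power[OF k])
  also have "\<dots> \<le> (2 * e * real n ^ 2 / real k) ^ k"
    using c2 e k by (intro power_mono divide_right_mono) auto
  finally have b1: "real (((2 * n) choose 2) choose k) \<le> (2 * e * real n ^ 2 / real k) ^ k" .
  have "real ((2 * n) choose (2 * k)) \<le> (e * real (2 * n) / real (2 * k)) ^ (2 * k)"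
    unfolding e_def using k by (intro binomial_le_exp_power) auto
  also have "\<dots> = ((e * real n / real k)\<^sup>2) ^ k" by (simp add: power_mult)
  finally have b2: "real ((2 * n) choose (2 * k)) ^ q \<le> (((e * real n / real k)\<^sup>2) ^ k) ^ q"
    by (intro power_mono) auto
  have b3: "real (num_matchings (n - r * k)) \<le> ((e / n) ^ r) ^ k * num_matchings n"
    using num_matchings_diff_le[OF True n] by (simp add: e_def power_mult)
  have "card {M \<in> perfect_matchings n V. \<exists>T. twins r M k T}
      \<le> real ((((2 * n) choose 2) choose k) * ((2 * n) choose (2 * k)) ^ q * num_matchings (n - r * k))"
    using card_matchings_with_twins_le[OF V r, of k] q by (intro of_nat_mono) simp
  also have "\<dots> = real (((2 * n) choose 2) choose k) * real ((2 * n) choose (2 * k)) ^ q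
      * real (num_matchings (n - r * k))" by simp
  also have "\<dots> \<le> (2 * e * real n ^ 2 / real k) ^ k * (((e * real n / real k)\<^sup>2) ^ k) ^ q
      * (((e / n) ^ r) ^ k * num_matchings n)"
    using b1 b2 b3 e by (intro mult_mono) auto
  also have "\<dots> = (2 * e * real n ^ 2 / real k * ((e * real n / real k)\<^sup>2) ^ q * (e / n) ^ r) ^ k * num_matchings n"
    by (simp only: power_mult_distrib power_mult[symmetric] mult_ac)
  also have "2 * e * real n ^ 2 / real k * ((e * real n / real k)\<^sup>2) ^ q * (e / n) ^ r
      = 2 * e ^ (3 * r - 1) * real n ^ r / real k ^ (2 * r - 1)"
  proof -
    have "e ^ (3 * r - 1) = e * (e ^ q)\<^sup>2 * e ^ r"
      unfolding q by (simp add: power2_eq_square power_add[symmetric] numeral_3_eq_3 add.assoc)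
    moreover have "real k ^ (2 * r - 1) = real k * (real k ^ q)\<^sup>2"
      unfolding q by (simp add: power2_eq_square power_add[symmetric] mult_2)
    moreover have "real n ^ 2 * (real n ^ q)\<^sup>2 = real n ^ r * real n ^ r"
      unfolding q by (simp add: power2_eq_square)
    ultimately show ?thesis
      using n k by (simp add: power_divide power_mult_distrib power_mult[symmetric] mult.commute[of 2 q]
         field_simps)
  qed
  finally show ?thesis by (simp add: e_def)
qed

lemma sum_half_powers_le: "(\<Sum>k\<in>{K..n}. (1 / 2 :: real) ^ k) \<le> 2 * (1 / 2) ^ K"
proof -
  have "(\<Sum>k\<in>{K..<K + j}. (1 / 2 :: real) ^ k) = 2 * (1 / 2) ^ K - 2 * (1 / 2) ^ (K + j)" for j
    by (induction j) simp_all
  from this[of "Suc n - K"] show ?thesis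
    by (cases "K \<le> n") (simp_all add: atLeastLessThanSuc_atLeastAtMost del: power_Suc)
qed

lemma twins_max_twins:
  assumes "finite M" "r \<ge> 1"
  shows "\<exists>T. twins r M (max_twins r M) T"
  using Max_in[OF finite_twins_sizes[OF assms]] twins_empty[of r M] unfolding max_twins_def by blast

text \<open>The maximum is itself a size \<open>k\<close> between \<open>K\<close> and
  \<open>n\<close> that twins attain. The hypothesis \<open>large\<close> makes the base of the
  \<open>k\<close>-th power at most 1/2 for all these \<open>k\<close>, so the union bound is a
  geometric sum.\<close>

lemma card_max_twins_ge_le:
  assumes V: "finite V" "card V = 2 * n" and r: "r \<ge> 1" and K: "K > 0"
    and large: "4 * exp 1 ^ (3 * r - 1) * real n ^ r \<le> real K ^ (2 * r - 1)"
  shows "card {M \<in> perfect_matchings n V. K \<le> max_twins r M} \<le> 2 * (1 / 2) ^ K * num_matchings n"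
proof -
  let ?A = "\<lambda>k. {M \<in> perfect_matchings n V. \<exists>T. twins r M k T}"
  have fin: "finite (?A k)" for k using finite_perfect_matchings[OF V(1)] by simp
  have "{M \<in> perfect_matchings n V. K \<le> max_twins r M} \<subseteq> (\<Union>k\<in>{K..n}. ?A k)"
  proof
    fix M assume M: "M \<in> {M \<in> perfect_matchings n V. K \<le> max_twins r M}"
    then have fM: "finite M" and cM: "card M = n" using ordered_matching_finite by (auto simp: ordered_matching_def)
    obtain T where T: "twins r M (max_twins r M) T" using twins_max_twins[OF fM r] by blast
    then have "T 0 \<subseteq> M" "card (T 0) = max_twins r M" using r by (auto simp: twins_def)
    then have "max_twins r M \<le> n" using card_mono[OF fM] cM by metis
    then show "M \<in> (\<Union>k\<in>{K..n}. ?A k)" using M T by auto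
  qed
  then have "card {M \<in> perfect_matchings n V. K \<le> max_twins r M} \<le> (\<Sum>k\<in>{K..n}. card (?A k))"
    by (intro order_trans[OF card_mono card_UN_le]) (use fin in auto)
  then have "real (card {M \<in> perfect_matchings n V. K \<le> max_twins r M}) \<le> (\<Sum>k\<in>{K..n}. real (card (?A k)))"
    using of_nat_mono[where 'a = real] by fastforce
  also have "\<dots> \<le> (\<Sum>k\<in>{K..n}. (1 / 2) ^ k * num_matchings n)"
  proof (rule sum_mono)
    fix k assume k: "k \<in> {K..n}"
    then have "real K ^ (2 * r - 1) \<le> real k ^ (2 * r - 1)" by (intro power_mono) auto
    then have "2 * exp 1 ^ (3 * r - 1) * real n ^ r / real k ^ (2 * r - 1) \<le> 1 / 2"
      using large k K by (simp add: field_simps)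
    then have "(2 * exp 1 ^ (3 * r - 1) * real n ^ r / real k ^ (2 * r - 1)) ^ k \<le> (1 / 2) ^ k"
      by (intro power_mono) auto
    then have "(2 * exp 1 ^ (3 * r - 1) * real n ^ r / real k ^ (2 * r - 1)) ^ k * num_matchings n
        \<le> (1 / 2) ^ k * num_matchings n"
      by (intro mult_right_mono) auto
    then show "real (card (?A k)) \<le> (1 / 2) ^ k * num_matchings n"
      using card_matchings_with_twins_le_power[OF V r, of k] k K by simp
  qed
  also have "\<dots> \<le> 2 * (1 / 2) ^ K * num_matchings n"
    unfolding sum_distrib_right[symmetric] by (intro mult_right_mono sum_half_powers_le) auto
  finally show ?thesis .
qed

subsection \<open>Twins from linked pairs of blocks\<close>

lemma sorted_list_of_set_image:
  assumes "finite Q" "strict_mono_on Q w"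
  shows "sorted_list_of_set (w ` Q) = map w (sorted_list_of_set Q)"
proof -
  have "sorted_wrt (\<lambda>x y. w x < w y) (sorted_list_of_set Q)"
    by (rule sorted_wrt_mono_rel[OF _ strict_sorted_list_of_set])
       (use assms in \<open>auto simp: strict_mono_on_def\<close>)
  moreover have "card (w ` Q) = card Q"
    using strict_mono_on_imp_inj_on[OF assms(2)] by (rule card_image)
  ultimately show ?thesis
    using assms(1) by (intro sorted_list_of_set_unique[THEN iffD1]) (auto simp: sorted_wrt_map)
qed

text \<open>Both vertex sets are listed as images of the same sorted list of \<open>Q\<close>, so
  equal positions come from equal elements of \<open>Q\<close>, and injectivity pulls edges back to
  \<open>E\<close>.\<close>

lemma order_isomorphic_images:
  fixes Q :: "'c::linorder set"
  assumes Q: "finite Q" and w: "strict_mono_on Q w" "strict_mono_on Q w'" and E: "E \<subseteq> Pow Q"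
  shows "order_isomorphic (w ` Q) ((`) w ` E) (w' ` Q) ((`) w' ` E)"
proof -
  have inj: "inj_on w Q" "inj_on w' Q" using w by (auto intro: strict_mono_on_imp_inj_on)
  have iff: "{f a, f b} \<in> (`) f ` E \<longleftrightarrow> {a, b} \<in> E"
    if "a \<in> Q" "b \<in> Q" "inj_on f Q" for a b and f :: "_ \<Rightarrow> 'z"
  proof -
    have "{f a, f b} \<in> (`) f ` E \<longleftrightarrow> (\<exists>e\<in>E. f ` {a, b} = f ` e)" by auto
    also have "\<dots> \<longleftrightarrow> (\<exists>e\<in>E. {a, b} = e)"
      using that E inj_on_image_eq_iff[OF that(3), of "{a, b}"]
      by (metis PowD empty_subsetI insert_subset subsetD)
    finally show ?thesis by auto
  qed
  have mem: "sorted_list_of_set Q ! i \<in> Q" if "i < card Q" for i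
    using that Q by (metis length_sorted_list_of_set nth_mem set_sorted_list_of_set)
  show ?thesis
    unfolding order_isomorphic_def sorted_list_of_set_image[OF Q w(1)] sorted_list_of_set_image[OF Q w(2)]
    using inj Q by (auto simp: card_image iff mem)
qed

text \<open>\<open>S q i\<close> is the \<open>i\<close>-th part of block \<open>q\<close>; there
  are \<open>N\<close> blocks of \<open>r\<close> parts with \<open>s\<close> vertices each. Every
  vertex of an earlier block precedes every vertex of a later one, so any choice of one vertex per
  block is increasing in the block index.\<close>

locale block_grid =
  fixes S :: "nat \<Rightarrow> nat \<Rightarrow> 'a::linorder set" and N r s n :: nat and V :: "'a set"
  assumes finite_V: "finite V" and card_V: "card V = 2 * n"
    and S_subset: "\<And>q i. q < N \<Longrightarrow> i < r \<Longrightarrow> S q i \<subseteq> V"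
    and card_S: "\<And>q i. q < N \<Longrightarrow> i < r \<Longrightarrow> card (S q i) = s"
    and S_disjoint: "\<And>q i j. q < N \<Longrightarrow> i < r \<Longrightarrow> j < r \<Longrightarrow> i \<noteq> j \<Longrightarrow> S q i \<inter> S q j = {}"
    and S_less: "\<And>q q' i j u v. q < q' \<Longrightarrow> q' < N \<Longrightarrow> i < r \<Longrightarrow> j < r \<Longrightarrow>
       u \<in> S q i \<Longrightarrow> v \<in> S q' j \<Longrightarrow> u < v"
    and r_pos: "r > 0"
begin

section \<open>Packings of linked block pairs\<close>

lemma S_unique:
  assumes "u \<in> S q i" "u \<in> S q' j" "q < N" "q' < N" "i < r" "j < r"
  shows "q = q' \<and> i = j"
proof -
  have "\<not> q < q'" "\<not> q' < q"
    using S_less assms by (meson less_irrefl)+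
  then show ?thesis using S_disjoint assms by (metis IntI empty_iff linorder_neqE_nat)
qed

lemma finite_S: "q < N \<Longrightarrow> i < r \<Longrightarrow> finite (S q i)"
  using S_subset finite_V finite_subset by blast

definition block_pairs :: "(nat \<times> nat) set" where
  "block_pairs = {(q, q'). q < q' \<and> q' < N}"

definition linked :: "'a set set \<Rightarrow> nat \<times> nat \<Rightarrow> bool" where
  "linked M p \<longleftrightarrow> (\<forall>i<r. \<exists>u\<in>S (fst p) i. \<exists>v\<in>S (snd p) i. {u, v} \<in> M)"

text \<open>The matchings of the graph whose vertices are the blocks and whose edges are the linked
  pairs; \<open>max_packed\<close> is then its matching number.\<close>

definition packed :: "'a set set \<Rightarrow> (nat \<times> nat) set \<Rightarrow> bool" where
  "packed M P \<longleftrightarrow> P \<subseteq> block_pairs \<and> (\<forall>p\<in>P. linked M p) \<and>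
     (\<forall>p\<in>P. \<forall>p'\<in>P. p \<noteq> p' \<longrightarrow> disjnt {fst p, snd p} {fst p', snd p'})"

definition max_packed :: "'a set set \<Rightarrow> nat" where
  "max_packed M = Max (card ` {P. packed M P})"

lemma block_pairsD: "p \<in> block_pairs \<Longrightarrow> fst p < snd p \<and> fst p < N \<and> snd p < N"
  by (auto simp: block_pairs_def)

lemma finite_block_pairs: "finite block_pairs"
  by (rule finite_subset[of _ "{..<N} \<times> {..<N}"]) (auto simp: block_pairs_def)

lemma packed_block_pairs: "packed M P \<Longrightarrow> P \<subseteq> block_pairs"
  by (simp add: packed_def)

lemma packed_linked: "packed M P \<Longrightarrow> p \<in> P \<Longrightarrow> linked M p"
  by (simp add: packed_def)

lemma packed_eq:
  assumes "packed M P" "p \<in> P" "p' \<in> P" "q \<in> {fst p, snd p}" "q \<in> {fst p', snd p'}"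
  shows "p = p'"
proof (rule ccontr)
  assume "p \<noteq> p'"
  with assms(1-3) have "disjnt {fst p, snd p} {fst p', snd p'}" by (simp add: packed_def)
  with assms(4,5) show False by (meson disjnt_iff)
qed

lemma finite_packed: "finite {P. packed M P}"
  by (rule finite_subset[of _ "Pow block_pairs"]) (auto simp: packed_def finite_block_pairs)

lemma max_packed_ge: "packed M P \<Longrightarrow> card P \<le> max_packed M"
  unfolding max_packed_def using finite_packed by (intro Max_ge) auto

lemma max_packed_attained: "\<exists>P. packed M P \<and> card P = max_packed M"
proof -
  have "packed M {}" by (simp add: packed_def)
  then have "max_packed M \<in> card ` {P. packed M P}"
    unfolding max_packed_def using finite_packed by (intro Max_in) auto
  then show ?thesis by auto
qed

text \<open>Twin \<open>i\<close> takes one edge between the \<open>i\<close>-th parts of each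
  packed pair. All twins are images of the same matching \<open>E\<close> on the set
  \<open>Q\<close> of used blocks, under maps \<open>w i\<close> that are increasing because the
  blocks are ordered; they are disjoint because the parts are.\<close>

lemma packed_imp_twins:
  assumes P: "packed M P"
  shows "\<exists>T. twins r M (card P) T"
proof -
  have bp: "fst p < snd p" "fst p < N" "snd p < N" if "p \<in> P" for p
    using that packed_block_pairs[OF P] block_pairsD[of p] by auto
  have dj: "p = p'" if "p \<in> P" "p' \<in> P" "q \<in> {fst p, snd p}" "q \<in> {fst p', snd p'}" for p p' q
    using packed_eq[OF P that] .
  define h where "h p i = (SOME x. fst x \<in> S (fst p) i \<and> snd x \<in> S (snd p) i \<and> {fst x, snd x} \<in> M)" for p i
  define u where "u p i = fst (h p i)" for p i
  define v where "v p i = snd (h p i)" for p i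
  have uv: "u p i \<in> S (fst p) i \<and> v p i \<in> S (snd p) i \<and> {u p i, v p i} \<in> M"
    if p: "p \<in> P" and i: "i < r" for p i
  proof -
    obtain a b where "a \<in> S (fst p) i" "b \<in> S (snd p) i" "{a, b} \<in> M"
      using packed_linked[OF P p] i unfolding linked_def by blast
    then have "\<exists>x. fst x \<in> S (fst p) i \<and> snd x \<in> S (snd p) i \<and> {fst x, snd x} \<in> M"
      by (intro exI[of _ "(a, b)"]) simp
    from someI_ex[OF this] show ?thesis unfolding u_def v_def h_def .
  qed
  have inj: "inj_on fst P" "inj_on snd P"
  proof -
    have "p = p'" if "p \<in> P" "p' \<in> P" "fst p = fst p'" for p p'
      using dj[of p p' "fst p"] that by simp
    then show "inj_on fst P" by (rule inj_onI)
    have "p = p'" if "p \<in> P" "p' \<in> P" "snd p = snd p'" for p p'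
      using dj[of p p' "snd p"] that by simp
    then show "inj_on snd P" by (rule inj_onI)
  qed
  \<comment> \<open>No block is the first block of one pair and the second of another, so the case
    distinction in \<open>w\<close> below is unambiguous.\<close>
  have sf: "snd p \<notin> fst ` P" if "p \<in> P" for p
  proof
    assume "snd p \<in> fst ` P"
    then obtain p' where p': "p' \<in> P" "snd p = fst p'" by auto
    then have "p = p'" using dj[of p p' "snd p"] \<open>p \<in> P\<close> by simp
    then show False using p' bp[of p'] by simp
  qed
  \<comment> \<open>Each used block lies in exactly one packed pair, which \<open>inv_into\<close>
    recovers; \<open>w i\<close> sends the block to the endpoint chosen in its \<open>i\<close>-th
    part.\<close>
  define w where "w i q = (if q \<in> fst ` P then u (inv_into P fst q) i else v (inv_into P snd q) i)" for i q
  have wu: "w i (fst p) = u p i" and wv: "w i (snd p) = v p i" if "p \<in> P" for i p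
    using that sf[OF that] inj by (simp_all add: w_def)
  define Q where "Q = fst ` P \<union> snd ` P"
  define E where "E = (\<lambda>p. {fst p, snd p}) ` P"
  define T where "T i = (`) (w i) ` E" for i
  have finP: "finite P" using packed_block_pairs[OF P] finite_block_pairs by (rule finite_subset)
  then have finQ: "finite Q" by (simp add: Q_def)
  have EQ: "E \<subseteq> Pow Q" "\<Union>E = Q" by (auto simp: E_def Q_def)
  have wS: "w i q \<in> S q i" if "q \<in> Q" "i < r" for i q
    using that wu wv uv by (auto simp: Q_def)
  have QN: "q < N" if "q \<in> Q" for q using that bp by (auto simp: Q_def)
  have mono: "strict_mono_on Q (w i)" if "i < r" for i
    using S_less wS QN that by (intro strict_mono_onI) blast
  have UT: "\<Union>(T i) = w i ` Q" for i using EQ(2) by (auto simp: T_def)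
  have "card (T i) = card P" if i: "i < r" for i
  proof -
    have "inj_on ((`) (w i)) E"
      using inj_on_image_Pow[OF strict_mono_on_imp_inj_on[OF mono[OF i]]] EQ(1) by (rule inj_on_subset)
    moreover have "inj_on (\<lambda>p. {fst p, snd p}) P"
    proof (rule inj_onI)
      fix p p' assume "p \<in> P" "p' \<in> P" "{fst p, snd p} = {fst p', snd p'}"
      then show "p = p'" using dj[of p p' "fst p"] by blast
    qed
    ultimately show ?thesis by (simp add: T_def E_def card_image)
  qed
  moreover have "T i \<subseteq> M" if "i < r" for i
    using that uv wu wv by (auto simp: T_def E_def)
  moreover have "T i \<inter> T j = {}" if "i < r" "j < r" "i \<noteq> j" for i j
  proof (rule ccontr)
    assume "T i \<inter> T j \<noteq> {}"
    then obtain e e' where e: "e \<in> E" "e' \<in> E" "w i ` e = w j ` e'" by (auto simp: T_def)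
    then obtain q where q: "q \<in> e" by (auto simp: E_def)
    then obtain q' where q': "q' \<in> e'" "w i q = w j q'" using e(3) by blast
    then have "q \<in> Q" "q' \<in> Q" using q e EQ by auto
    then show False using S_unique[of "w i q" q i q' j] wS[of q i] wS[of q' j] q' QN that by simp
  qed
  moreover have "order_isomorphic (\<Union>(T i)) (T i) (\<Union>(T j)) (T j)" if "i < r" "j < r" for i j
    unfolding UT unfolding T_def using that finQ mono EQ by (intro order_isomorphic_images) auto
  ultimately have "twins r M (card P) T" by (simp add: twins_def)
  then show ?thesis by blast
qed

lemma max_packed_le_max_twins:
  assumes "finite M"
  shows "max_packed M \<le> max_twins r M"
proof -
  obtain P where "packed M P" "card P = max_packed M" using max_packed_attained by blast
  with packed_imp_twins[of M P] have "max_packed M \<in> {k. \<exists>T. twins r M k T}" by auto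
  then show ?thesis unfolding max_twins_def
    using finite_twins_sizes[OF assms] r_pos by (intro Max_ge) auto
qed

text \<open>The pairs of a packing share no block, so each of \<open>a\<close> and \<open>b\<close>
  lies in the blocks of at most one pair. Dropping these at most two pairs from an optimal packing
  leaves pairs whose linking edges the transposition fixes.\<close>

lemma max_packed_swap_le: "max_packed M \<le> max_packed (swap_vertices a b M) + 2"
proof -
  obtain P where P: "packed M P" and cP: "card P = max_packed M" using max_packed_attained by blast
  define B where "B p = (\<Union>i<r. S (fst p) i \<union> S (snd p) i)" for p
  define D where "D c = {p \<in> P. c \<in> B p}" for c
  have finP: "finite P" using packed_block_pairs[OF P] finite_block_pairs by (rule finite_subset)
  have D1: "card (D c) \<le> Suc 0" for c
  proof -
    have "p = p'" if p: "p \<in> D c" "p' \<in> D c" for p p'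
    proof -
      obtain q i where q: "q \<in> {fst p, snd p}" "i < r" "c \<in> S q i"
        using p by (auto simp: D_def B_def)
      obtain q' i' where q': "q' \<in> {fst p', snd p'}" "i' < r" "c \<in> S q' i'"
        using p by (auto simp: D_def B_def)
      have "p \<in> block_pairs" "p' \<in> block_pairs"
        using p packed_block_pairs[OF P] by (auto simp: D_def)
      then have "q < N" "q' < N"
        using q(1) q'(1) block_pairsD[of p] block_pairsD[of p'] by auto
      then have "q = q'" using S_unique q q' by blast
      then show ?thesis using packed_eq[OF P, of p p' q] p q q' by (simp add: D_def)
    qed
    then show ?thesis using finP by (subst card_le_Suc0_iff_eq) (auto simp: D_def)
  qed
  define P' where "P' = P - (D a \<union> D b)"
  have "packed (swap_vertices a b M) P'"
  proof -
    have "linked (swap_vertices a b M) p" if p: "p \<in> P'" for p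
      unfolding linked_def
    proof (intro allI impI)
      fix i assume i: "i < r"
      have "linked M p" using packed_linked[OF P] p by (simp add: P'_def)
      then obtain u v where uv: "u \<in> S (fst p) i" "v \<in> S (snd p) i" "{u, v} \<in> M"
        using i unfolding linked_def by blast
      have "a \<notin> B p" "b \<notin> B p" using p by (auto simp: P'_def D_def)
      moreover have "u \<in> B p" "v \<in> B p" using uv i by (auto simp: B_def)
      ultimately have "Transposition.transpose a b ` {u, v} = {u, v}"
        by (auto simp: Transposition.transpose_def)
      then have "{u, v} \<in> swap_vertices a b M" using uv(3) by (metis imageI)
      then show "\<exists>u\<in>S (fst p) i. \<exists>v\<in>S (snd p) i. {u, v} \<in> swap_vertices a b M"
        using uv by blast
    qed
    then show ?thesis using P by (simp add: packed_def P'_def subset_iff)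
  qed
  then have "card P' \<le> max_packed (swap_vertices a b M)" by (rule max_packed_ge)
  moreover have "card P \<le> card P' + card (D a \<union> D b)"
    unfolding P'_def using finP by (simp add: D_def diff_card_le_card_Diff le_diff_conv[symmetric])
  moreover have "card (D a \<union> D b) \<le> 2"
    using card_Un_le[of "D a" "D b"] D1[of a] D1[of b] by linarith
  ultimately show ?thesis using cP by linarith
qed

section \<open>The expected number of isolated linked pairs\<close>

text \<open>A bundle picks one candidate edge between the \<open>i\<close>-th parts for each
  \<open>i\<close>, so \<open>p\<close> is linked in \<open>M\<close> exactly when some bundle has
  all its edges in \<open>M\<close>. Extensional functions make distinct choices distinct bundles
  and keep the set finite.\<close>

definition bundles :: "nat \<times> nat \<Rightarrow> (nat \<Rightarrow> 'a \<times> 'a) set" where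
  "bundles p = (\<Pi>\<^sub>E i\<in>{..<r}. S (fst p) i \<times> S (snd p) i)"

definition bundle_edges :: "(nat \<Rightarrow> 'a \<times> 'a) \<Rightarrow> 'a set set" where
  "bundle_edges h = (\<lambda>i. {fst (h i), snd (h i)}) ` {..<r}"

definition extra_edges :: "nat \<times> nat \<Rightarrow> (nat \<Rightarrow> 'a \<times> 'a) \<Rightarrow> 'a set set" where
  "extra_edges p h = {{u, v} | u v. \<exists>i<r. u \<in> S (fst p) i \<and> v \<in> S (snd p) i \<and> (u, v) \<noteq> h i}"

definition adjacent_pairs :: "nat \<times> nat \<Rightarrow> (nat \<times> nat) set" where
  "adjacent_pairs p = {p' \<in> block_pairs. p' \<noteq> p \<and> \<not> disjnt {fst p, snd p} {fst p', snd p'}}"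

text \<open>The last two conditions make distinct good bundles belong to disjoint block pairs; a violation of
  either forces \<open>M\<close> to contain one, respectively \<open>r\<close>, further edges, so that a union bound suffices.\<close>

definition good_bundles :: "'a set set \<Rightarrow> ((nat \<times> nat) \<times> (nat \<Rightarrow> 'a \<times> 'a)) set" where
  "good_bundles M = {(p, h). p \<in> block_pairs \<and> h \<in> bundles p \<and> bundle_edges h \<subseteq> M \<and>
     extra_edges p h \<inter> M = {} \<and> (\<forall>p'\<in>adjacent_pairs p. \<forall>h'\<in>bundles p'. \<not> bundle_edges h' \<subseteq> M)}"

lemma bundlesD:
  assumes "h \<in> bundles p" "i < r"
  shows "fst (h i) \<in> S (fst p) i" "snd (h i) \<in> S (snd p) i"
proof -
  have "h i \<in> S (fst p) i \<times> S (snd p) i"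
    using assms by (auto simp: bundles_def dest: PiE_mem)
  then show "fst (h i) \<in> S (fst p) i" "snd (h i) \<in> S (snd p) i" by auto
qed

text \<open>The endpoint in the earlier block is the smaller one, so an unordered edge determines
  its oriented endpoints, and these determine their blocks and parts.\<close>

lemma edge_unique:
  assumes "p \<in> block_pairs" "p' \<in> block_pairs" "i < r" "j < r"
    and "u \<in> S (fst p) i" "v \<in> S (snd p) i" "u' \<in> S (fst p') j" "v' \<in> S (snd p') j"
    and "{u, v} = {u', v'}"
  shows "u = u' \<and> v = v' \<and> p = p' \<and> i = j"
proof -
  have "u < v" "u' < v'"
    using S_less[of "fst p" "snd p" i i u v] S_less[of "fst p'" "snd p'" j j u' v']
      block_pairsD[OF assms(1)] block_pairsD[OF assms(2)] assms(3-8) by auto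
  then have eq: "u = u'" "v = v'" using assms(9) by (auto simp: doubleton_eq_iff)
  then have "fst p = fst p' \<and> i = j" "snd p = snd p' \<and> i = j"
    using S_unique[of u "fst p" i "fst p'" j] S_unique[of v "snd p" i "snd p'" j]
      block_pairsD[OF assms(1)] block_pairsD[OF assms(2)] assms(3-8) by auto
  then show ?thesis using eq by (simp add: prod_eq_iff)
qed

lemma card_bundles: "p \<in> block_pairs \<Longrightarrow> card (bundles p) = s ^ (2 * r)"
  using block_pairsD[of p] card_S
  by (simp add: bundles_def card_PiE card_cartesian_product power_mult power2_eq_square)

lemma finite_bundles: "p \<in> block_pairs \<Longrightarrow> finite (bundles p)"
  using block_pairsD[of p] finite_S by (auto simp: bundles_def intro!: finite_PiE)

lemma card_extra_edges:
  assumes "p \<in> block_pairs"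
  shows "finite (extra_edges p h)" "card (extra_edges p h) \<le> r * s\<^sup>2"
proof -
  let ?A = "\<lambda>i. (\<lambda>(u, v). {u, v}) ` (S (fst p) i \<times> S (snd p) i)"
  have sub: "extra_edges p h \<subseteq> (\<Union>i<r. ?A i)" by (auto simp: extra_edges_def)
  have fin: "finite (?A i)" if "i < r" for i
    using that block_pairsD[OF assms] finite_S by auto
  then show "finite (extra_edges p h)" using sub finite_subset by blast
  have "card (extra_edges p h) \<le> card (\<Union>i<r. ?A i)"
    using fin by (intro card_mono[OF _ sub]) auto
  also have "\<dots> \<le> (\<Sum>i<r. card (?A i))" by (rule card_UN_le) simp
  also have "\<dots> \<le> (\<Sum>i<r. s\<^sup>2)"
  proof (rule sum_mono)
    fix i assume "i \<in> {..<r}"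
    then show "card (?A i) \<le> s\<^sup>2"
      using block_pairsD[OF assms] finite_S card_S
        card_image_le[of "S (fst p) i \<times> S (snd p) i" "\<lambda>(u, v). {u, v}"]
      by (simp add: card_cartesian_product power2_eq_square)
  qed
  finally show "card (extra_edges p h) \<le> r * s\<^sup>2" by simp
qed

text \<open>An adjacent pair is determined by the block it shares with \<open>p\<close>, for which
  there are two choices, and by its other block.\<close>

lemma card_adjacent_pairs: "card (adjacent_pairs p) \<le> 2 * N"
proof -
  let ?A = "\<lambda>a. (\<lambda>x. if x < a then (x, a) else (a, x)) ` {..<N}"
  have "adjacent_pairs p \<subseteq> ?A (fst p) \<union> ?A (snd p)"
  proof
    fix p' assume p': "p' \<in> adjacent_pairs p"
    then have bp: "fst p' < snd p'" "fst p' < N" "snd p' < N"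
      using block_pairsD[of p'] by (auto simp: adjacent_pairs_def)
    have "p' \<in> ?A (fst p')" "p' \<in> ?A (snd p')"
      using bp by (auto simp: image_iff prod_eq_iff)
    moreover have "fst p' \<in> {fst p, snd p} \<or> snd p' \<in> {fst p, snd p}"
      using p' by (auto simp: adjacent_pairs_def disjnt_def)
    ultimately show "p' \<in> ?A (fst p) \<union> ?A (snd p)" by auto
  qed
  then have "card (adjacent_pairs p) \<le> card (?A (fst p) \<union> ?A (snd p))"
    by (intro card_mono) auto
  also have "\<dots> \<le> card (?A (fst p)) + card (?A (snd p))" by (rule card_Un_le)
  also have "\<dots> \<le> N + N"
    by (intro add_mono order_trans[OF card_image_le]) auto
  finally show ?thesis by simp
qed

lemma card_bundle_edges:
  assumes p: "p \<in> block_pairs" and h: "h \<in> bundles p"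
  shows "card (bundle_edges h) = r" "pairwise disjnt (bundle_edges h)"
    "bundle_edges h \<subseteq> {e. e \<subseteq> V \<and> card e = 2}"
proof -
  have dj: "i = j" if "i < r" "j < r" "{fst (h i), snd (h i)} \<inter> {fst (h j), snd (h j)} \<noteq> {}" for i j
    using that bundlesD[OF h] block_pairsD[OF p] S_unique by (auto; metis)
  have "inj_on (\<lambda>i. {fst (h i), snd (h i)}) {..<r}"
    using dj by (intro inj_onI) auto
  then show "card (bundle_edges h) = r" by (simp add: bundle_edges_def card_image)
  show "pairwise disjnt (bundle_edges h)"
    unfolding pairwise_def bundle_edges_def disjnt_def using dj by blast
  have "fst (h i) < snd (h i)" "fst (h i) \<in> V" "snd (h i) \<in> V" if "i < r" for i
    using bundlesD[OF h that] block_pairsD[OF p] S_less S_subset that by blast+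
  then show "bundle_edges h \<subseteq> {e. e \<subseteq> V \<and> card e = 2}"
    by (auto simp: bundle_edges_def card_2_iff) (metis less_irrefl)
qed

lemma extra_edge_notin:
  assumes "p \<in> block_pairs" "h \<in> bundles p" "e \<in> extra_edges p h"
  shows "e \<notin> bundle_edges h"
proof
  assume "e \<in> bundle_edges h"
  then obtain j where j: "j < r" "e = {fst (h j), snd (h j)}" by (auto simp: bundle_edges_def)
  from assms(3) obtain u v i where uv: "e = {u, v}" "i < r" "u \<in> S (fst p) i" "v \<in> S (snd p) i" "(u, v) \<noteq> h i"
    by (auto simp: extra_edges_def)
  then have "u = fst (h j) \<and> v = snd (h j) \<and> p = p \<and> i = j"
    using j assms bundlesD[OF assms(2) j(1)] by (intro edge_unique) auto
  then show False using uv(5) by auto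
qed

lemma bundle_edges_disjoint:
  assumes "p \<in> block_pairs" "h \<in> bundles p" "p' \<in> block_pairs" "h' \<in> bundles p'" "p \<noteq> p'"
  shows "bundle_edges h \<inter> bundle_edges h' = {}"
proof -
  have "{fst (h i), snd (h i)} \<noteq> {fst (h' j), snd (h' j)}" if "i < r" "j < r" for i j
    using edge_unique[of p p' i j] bundlesD[OF assms(2)] bundlesD[OF assms(4)] assms that by blast
  then show ?thesis by (auto simp: bundle_edges_def)
qed

text \<open>Two bundles of one pair inside \<open>M\<close> would yield an extra edge, so good
  bundles are determined by their pairs; two good pairs that share a block would be adjacent. Hence
  the pairs of good bundles form a packing of the same size.\<close>

lemma card_good_bundles_le: "card (good_bundles M) \<le> max_packed M"
proof -
  have inj: "inj_on fst (good_bundles M)"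
  proof (rule inj_onI)
    fix x y assume x: "x \<in> good_bundles M" and y: "y \<in> good_bundles M" and eq: "fst x = fst y"
    obtain p h h' where xy: "x = (p, h)" "y = (p, h')" using eq by (cases x; cases y) auto
    have h: "h \<in> bundles p" "h' \<in> bundles p" "extra_edges p h \<inter> M = {}" "bundle_edges h' \<subseteq> M"
      using x y by (auto simp: good_bundles_def xy)
    have "h i = h' i" if i: "i < r" for i
    proof (rule ccontr)
      assume "h i \<noteq> h' i"
      then have "{fst (h' i), snd (h' i)} \<in> extra_edges p h"
        unfolding extra_edges_def using bundlesD[OF h(2) i] i
        by (intro CollectI exI[of _ "fst (h' i)"] exI[of _ "snd (h' i)"] conjI) auto
      moreover have "{fst (h' i), snd (h' i)} \<in> M"
        using h(4) i by (auto simp: bundle_edges_def)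
      ultimately show False using h(3) by blast
    qed
    then have "h = h'" using h(1,2) unfolding bundles_def by (intro PiE_ext) auto
    then show "x = y" by (simp add: xy)
  qed
  have "packed M (fst ` good_bundles M)"
    unfolding packed_def
  proof (intro conjI ballI impI)
    show "fst ` good_bundles M \<subseteq> block_pairs" by (auto simp: good_bundles_def)
  next
    fix p assume "p \<in> fst ` good_bundles M"
    then obtain h where h: "h \<in> bundles p" "bundle_edges h \<subseteq> M" by (auto simp: good_bundles_def)
    show "linked M p" unfolding linked_def
    proof (intro allI impI)
      fix i assume i: "i < r"
      then have "{fst (h i), snd (h i)} \<in> M" using h(2) by (auto simp: bundle_edges_def)
      then show "\<exists>u\<in>S (fst p) i. \<exists>v\<in>S (snd p) i. {u, v} \<in> M" using bundlesD[OF h(1) i] by blast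
    qed
  next
    fix p p' assume p: "p \<in> fst ` good_bundles M" and p': "p' \<in> fst ` good_bundles M" and ne: "p \<noteq> p'"
    from p' obtain h' where h': "h' \<in> bundles p'" "bundle_edges h' \<subseteq> M" "p' \<in> block_pairs"
      by (auto simp: good_bundles_def)
    from p have "\<not> bundle_edges h' \<subseteq> M" if "p' \<in> adjacent_pairs p"
      using that h' by (auto simp: good_bundles_def)
    then show "disjnt {fst p, snd p} {fst p', snd p'}"
      using h' ne by (auto simp: adjacent_pairs_def)
  qed
  from max_packed_ge[OF this] show ?thesis by (simp add: card_image[OF inj])
qed

text \<open>A matching containing the edges of \<open>h\<close> in which \<open>(p, h)\<close> is
  not good lies in \<open>?Y\<close> or \<open>?Z\<close>: it contains an extra edge, fixing
  \<open>r + 1\<close> edges in all, or a bundle of an adjacent pair, fixing \<open>2 * r\<close>.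
  The loss is written additively to avoid truncated subtraction.\<close>

lemma card_good_ge:
  assumes p: "p \<in> block_pairs" and h: "h \<in> bundles p"
  shows "num_matchings (n - r) \<le> card {M \<in> perfect_matchings n V. (p, h) \<in> good_bundles M}
     + r * s\<^sup>2 * num_matchings (n - Suc r) + 2 * N * s ^ (2 * r) * num_matchings (n - 2 * r)"
proof -
  let ?P = "perfect_matchings n V"
  let ?C = "\<lambda>F. {M \<in> ?P. F \<subseteq> M}"
  let ?X = "{M \<in> ?P. (p, h) \<in> good_bundles M}"
  let ?Y = "\<Union>e\<in>extra_edges p h. ?C (insert e (bundle_edges h))"
  let ?Z = "\<Union>p'\<in>adjacent_pairs p. \<Union>h'\<in>bundles p'. ?C (bundle_edges h \<union> bundle_edges h')"
  note b = card_bundle_edges[OF p h]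
  have finP: "finite ?P" using finite_V by (rule finite_perfect_matchings)
  have adj: "p' \<in> block_pairs" "p' \<noteq> p" if "p' \<in> adjacent_pairs p" for p'
    using that by (auto simp: adjacent_pairs_def)
  have fin_adj: "finite (adjacent_pairs p)"
    using finite_block_pairs by (auto simp: adjacent_pairs_def)
  have fin_be: "finite (bundle_edges h')" for h' by (simp add: bundle_edges_def)
  have "num_matchings (n - r) = card (?C (bundle_edges h))"
    using card_matchings_containing[OF b(2,3) finite_V card_V] b(1) by simp
  also have "\<dots> \<le> card (?X \<union> ?Y \<union> ?Z)"
  proof (rule card_mono)
    show "finite (?X \<union> ?Y \<union> ?Z)" by (rule finite_subset[OF _ finP]) auto
    show "?C (bundle_edges h) \<subseteq> ?X \<union> ?Y \<union> ?Z" using p h by (auto simp: good_bundles_def)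
  qed
  also have "\<dots> \<le> card ?X + card ?Y + card ?Z"
    by (meson add_le_mono1 card_Un_le le_trans)
  also have "card ?Y \<le> r * s\<^sup>2 * num_matchings (n - Suc r)"
  proof -
    have "card ?Y \<le> (\<Sum>e\<in>extra_edges p h. card (?C (insert e (bundle_edges h))))"
      using card_extra_edges[OF p] by (intro card_UN_le) auto
    also have "\<dots> \<le> (\<Sum>e\<in>extra_edges p h. num_matchings (n - Suc r))"
    proof (rule sum_mono)
      fix e assume "e \<in> extra_edges p h"
      then have "card (insert e (bundle_edges h)) = Suc r"
        using extra_edge_notin[OF p h] b(1) fin_be by simp
      then show "card (?C (insert e (bundle_edges h))) \<le> num_matchings (n - Suc r)"
        using card_matchings_containing_le[OF finite_V card_V] by metis
    qed
    also have "\<dots> \<le> r * s\<^sup>2 * num_matchings (n - Suc r)"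
      using card_extra_edges[OF p] by simp
    finally show ?thesis .
  qed
  also have "card ?Z \<le> 2 * N * s ^ (2 * r) * num_matchings (n - 2 * r)"
  proof -
    have "card ?Z \<le> (\<Sum>p'\<in>adjacent_pairs p. card (\<Union>h'\<in>bundles p'. ?C (bundle_edges h \<union> bundle_edges h')))"
      using fin_adj by (intro card_UN_le)
    also have "\<dots> \<le> (\<Sum>p'\<in>adjacent_pairs p. s ^ (2 * r) * num_matchings (n - 2 * r))"
    proof (rule sum_mono)
      fix p' assume p': "p' \<in> adjacent_pairs p"
      have "card (\<Union>h'\<in>bundles p'. ?C (bundle_edges h \<union> bundle_edges h'))
          \<le> (\<Sum>h'\<in>bundles p'. card (?C (bundle_edges h \<union> bundle_edges h')))"
        using finite_bundles[OF adj(1)[OF p']] by (intro card_UN_le)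
      also have "\<dots> \<le> (\<Sum>h'\<in>bundles p'. num_matchings (n - 2 * r))"
      proof (rule sum_mono)
        fix h' assume h': "h' \<in> bundles p'"
        have "card (bundle_edges h \<union> bundle_edges h') = 2 * r"
          using bundle_edges_disjoint[OF p h adj(1)[OF p'] h'] adj(2)[OF p'] b(1)
            card_bundle_edges(1)[OF adj(1)[OF p'] h'] fin_be by (simp add: card_Un_disjoint)
        then show "card (?C (bundle_edges h \<union> bundle_edges h')) \<le> num_matchings (n - 2 * r)"
          using card_matchings_containing_le[OF finite_V card_V] by metis
      qed
      also have "\<dots> = s ^ (2 * r) * num_matchings (n - 2 * r)"
        using card_bundles[OF adj(1)[OF p']] by simp
      finally show "card (\<Union>h'\<in>bundles p'. ?C (bundle_edges h \<union> bundle_edges h'))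
          \<le> s ^ (2 * r) * num_matchings (n - 2 * r)" .
    qed
    also have "\<dots> \<le> 2 * N * s ^ (2 * r) * num_matchings (n - 2 * r)"
      using card_adjacent_pairs[of p] by (simp add: mult.assoc)
    finally show ?thesis .
  qed
  finally show ?thesis by simp
qed

text \<open>Linearity of expectation over all bundles. By \<open>sparse\<close>, at most half of the
  matchings containing a given bundle fail to make it good, and a bundle is contained with
  probability at least 1 / (2n)^r.\<close>

lemma sum_max_packed_ge:
  assumes n: "n \<ge> 4 * r"
    and sparse: "real r * real s ^ 2 / n + 2 * real N * real s ^ (2 * r) / real n ^ r \<le> 1 / 2"
  shows "(\<Sum>M\<in>perfect_matchings n V. real (max_packed M))
     \<ge> real (card block_pairs) * real s ^ (2 * r) / (2 * (2 * real n) ^ r) * num_matchings n"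
proof -
  let ?P = "perfect_matchings n V"
  let ?m = "\<lambda>k. real (num_matchings k)"
  define \<B> where "\<B> = Sigma block_pairs bundles"
  have finP: "finite ?P" using finite_V by (rule finite_perfect_matchings)
  have n0: "n > 0" using n r_pos by auto
  have fin\<B>: "finite \<B>" unfolding \<B>_def using finite_block_pairs finite_bundles by auto
  have c\<B>: "card \<B> = card block_pairs * s ^ (2 * r)"
    unfolding \<B>_def using finite_block_pairs finite_bundles card_bundles by (subst card_SigmaI) auto
  \<comment> \<open>Because of \<open>n \<ge> 4 * r\<close>, each of the at most \<open>r\<close>
    factors dropped below \<open>n - r\<close> is still at least \<open>n\<close>.\<close>
  have step: "real n ^ j * ?m (n - (r + j)) \<le> ?m (n - r)" if "j \<le> r" for j
    using that
  proof (induction j)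
    case (Suc j)
    have "num_matchings (n - (r + j)) = (2 * (n - (r + Suc j)) + 1) * num_matchings (n - (r + Suc j))"
      using num_matchings_Suc[of "n - (r + Suc j)"] n Suc.prems by (simp add: Suc_diff_Suc r_pos)
    moreover have "n \<le> 2 * (n - (r + Suc j)) + 1" using n Suc.prems by linarith
    ultimately have "n * num_matchings (n - (r + Suc j)) \<le> num_matchings (n - (r + j))"
      by (metis mult_le_mono1)
    then have "real n * ?m (n - (r + Suc j)) \<le> ?m (n - (r + j))"
      by (metis of_nat_mono of_nat_mult)
    then have "real n ^ j * (real n * ?m (n - (r + Suc j))) \<le> real n ^ j * ?m (n - (r + j))"
      by (intro mult_left_mono) auto
    then show ?case using Suc by (simp add: mult_ac)
  qed simp
  \<comment> \<open>In the other direction, every dropped factor is at most 2n.\<close>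
  have low: "?m n \<le> (2 * real n) ^ j * ?m (n - j)" if "j \<le> r" for j
    using that
  proof (induction j)
    case (Suc j)
    have "num_matchings (n - j) = (2 * (n - Suc j) + 1) * num_matchings (n - Suc j)"
      using num_matchings_Suc[of "n - Suc j"] n Suc.prems by (simp add: Suc_diff_Suc)
    moreover have "2 * (n - Suc j) + 1 \<le> 2 * n" using n0 by linarith
    ultimately have "num_matchings (n - j) \<le> 2 * n * num_matchings (n - Suc j)"
      by (metis mult_le_mono1)
    then have "?m (n - j) \<le> 2 * real n * ?m (n - Suc j)"
      by (metis of_nat_mono of_nat_mult of_nat_numeral)
    then have "(2 * real n) ^ j * ?m (n - j) \<le> (2 * real n) ^ j * (2 * real n * ?m (n - Suc j))"
      by (intro mult_left_mono) auto
    then show ?case using Suc by (simp add: mult_ac)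
  qed simp
  have s1: "?m (n - Suc r) \<le> ?m (n - r) / n"
    using step[of 1] r_pos n0 by (simp add: field_simps)
  have s2: "?m (n - 2 * r) \<le> ?m (n - r) / real n ^ r"
    using step[of r] n0 unfolding mult_2[symmetric] by (simp add: field_simps)
  have good: "?m (n - r) / 2 \<le> card {M \<in> ?P. x \<in> good_bundles M}" if x: "x \<in> \<B>" for x
  proof -
    obtain p h where ph: "x = (p, h)" "p \<in> block_pairs" "h \<in> bundles p" using x by (auto simp: \<B>_def)
    have "?m (n - r) \<le> real (card {M \<in> ?P. x \<in> good_bundles M}
       + r * s\<^sup>2 * num_matchings (n - Suc r) + 2 * N * s ^ (2 * r) * num_matchings (n - 2 * r))"
      using card_good_ge[OF ph(2,3)] unfolding ph(1) by (rule of_nat_mono)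
    also have "\<dots> = card {M \<in> ?P. x \<in> good_bundles M}
       + real r * real s ^ 2 * ?m (n - Suc r) + 2 * real N * real s ^ (2 * r) * ?m (n - 2 * r)" by simp
    also have "\<dots> \<le> card {M \<in> ?P. x \<in> good_bundles M}
       + real r * real s ^ 2 * (?m (n - r) / n) + 2 * real N * real s ^ (2 * r) * (?m (n - r) / real n ^ r)"
      using s1 s2 by (intro add_mono mult_left_mono order_refl) auto
    also have "\<dots> = card {M \<in> ?P. x \<in> good_bundles M}
       + (real r * real s ^ 2 / n + 2 * real N * real s ^ (2 * r) / real n ^ r) * ?m (n - r)"
      by (simp add: algebra_simps)
    also have "\<dots> \<le> card {M \<in> ?P. x \<in> good_bundles M} + 1 / 2 * ?m (n - r)"
      by (intro add_left_mono mult_right_mono sparse) auto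
    finally show ?thesis by simp
  qed
  have "real (card block_pairs) * real s ^ (2 * r) / (2 * (2 * real n) ^ r) * ?m n
      \<le> real (card block_pairs) * real s ^ (2 * r) / (2 * (2 * real n) ^ r) * ((2 * real n) ^ r * ?m (n - r))"
    by (intro mult_left_mono low) auto
  also have "\<dots> = (\<Sum>x\<in>\<B>. ?m (n - r) / 2)" using n0 by (simp add: c\<B>)
  also have "\<dots> \<le> (\<Sum>x\<in>\<B>. real (card {M \<in> ?P. x \<in> good_bundles M}))"
    by (intro sum_mono good)
  also have "\<dots> = (\<Sum>x\<in>\<B>. \<Sum>M\<in>?P. if x \<in> good_bundles M then 1 else 0)"
    using finP by (simp add: sum.If_cases Int_def)
  also have "\<dots> = (\<Sum>M\<in>?P. \<Sum>x\<in>\<B>. if x \<in> good_bundles M then 1 else 0)"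
    by (rule sum.swap)
  also have "\<dots> = (\<Sum>M\<in>?P. real (card (good_bundles M)))"
  proof (rule sum.cong[OF refl])
    fix M
    have "\<B> \<inter> good_bundles M = good_bundles M" by (auto simp: \<B>_def good_bundles_def)
    then show "(\<Sum>x\<in>\<B>. if x \<in> good_bundles M then 1 else 0) = real (card (good_bundles M))"
      using fin\<B> by (simp add: sum.If_cases Int_def Collect_mem_eq)
  qed
  also have "\<dots> \<le> (\<Sum>M\<in>?P. real (max_packed M))"
    using card_good_bundles_le by (intro sum_mono) simp
  finally show ?thesis .
qed

text \<open>The lower tail is bounded for \<open>max_packed\<close>, which changes by at most 2
  under a transposition, whence 16 = 4 * 2^2; it passes to \<open>max_twins\<close>, which is at
  least as large.\<close>

lemma card_max_packed_small_le:
  assumes n: "n \<ge> 4 * r"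
    and sparse: "real r * real s ^ 2 / n + 2 * real N * real s ^ (2 * r) / real n ^ r \<le> 1 / 2"
    and E: "0 < E" "E \<le> real (card block_pairs) * real s ^ (2 * r) / (2 * (2 * real n) ^ r)"
  shows "card {M \<in> perfect_matchings n V. max_twins r M < E / 2} \<le> 16 * n / E\<^sup>2 * num_matchings n"
proof -
  have "card {M \<in> perfect_matchings n V. max_twins r M < E / 2}
      \<le> card {M \<in> perfect_matchings n V. max_packed M < E / 2}"
  proof (rule card_mono)
    show "finite {M \<in> perfect_matchings n V. real (max_packed M) < E / 2}"
      using finite_perfect_matchings[OF finite_V] by simp
    show "{M \<in> perfect_matchings n V. max_twins r M < E / 2}
        \<subseteq> {M \<in> perfect_matchings n V. max_packed M < E / 2}"
    proof
      fix M assume M: "M \<in> {M \<in> perfect_matchings n V. max_twins r M < E / 2}"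
      then have "max_packed M \<le> max_twins r M"
        using max_packed_le_max_twins ordered_matching_finite by blast
      then show "M \<in> {M \<in> perfect_matchings n V. max_packed M < E / 2}" using M by auto
    qed
  qed
  also have "real (card {M \<in> perfect_matchings n V. max_packed M < E / 2})
      \<le> 4 * real n * 2\<^sup>2 / E\<^sup>2 * num_matchings n"
  proof (rule matchings_lower_tail[OF finite_V card_V])
    fix M a b
    show "\<bar>real (max_packed (swap_vertices a b M)) - real (max_packed M)\<bar> \<le> 2"
      using max_packed_swap_le[of M a b] max_packed_swap_le[of "swap_vertices a b M" a b] by simp
  next
    have "E * num_matchings n \<le> real (card block_pairs) * real s ^ (2 * r) / (2 * (2 * real n) ^ r) * num_matchings n"
      using E(2) by (intro mult_right_mono) auto
    also have "\<dots> \<le> (\<Sum>M\<in>perfect_matchings n V. real (max_packed M))"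
      by (rule sum_max_packed_ge[OF n sparse])
    finally show "E * num_matchings n \<le> (\<Sum>M\<in>perfect_matchings n V. real (max_packed M))" .
  qed (use E in auto)
  finally show ?thesis by simp
qed

end

subsection \<open>The order of magnitude\<close>

text \<open>All parts are consecutive intervals of length \<open>s\<close>, part \<open>i\<close> of
  block \<open>q\<close> having index \<open>q * r + i\<close>; \<open>Suc\<close> accounts for
  vertices starting at 1.\<close>

definition block :: "nat \<Rightarrow> nat \<Rightarrow> nat \<Rightarrow> nat \<Rightarrow> nat set" where
  "block r s q i = {Suc ((q * r + i) * s)..<Suc ((q * r + i) * s) + s}"

lemma block_less:
  assumes "q * r + i < q' * r + j" "u \<in> block r s q i" "v \<in> block r s q' j"
  shows "u < v"
proof -
  have "Suc (q * r + i) * s \<le> (q' * r + j) * s"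
    using assms(1) by (intro mult_le_mono1) simp
  then show ?thesis using assms(2,3) by (simp add: block_def)
qed

lemma index_less:
  fixes q q' r i j :: nat
  assumes "q < q'" "i < r"
  shows "q * r + i < q' * r + j"
proof -
  have "Suc q * r \<le> q' * r" using assms(1) by (intro mult_le_mono1) simp
  then show ?thesis using assms(2) by simp
qed

lemma block_grid_block:
  assumes "r > 0"
  shows "block_grid (block r s) (2 * n div (r * s)) r s n {1..2 * n}"
proof
  fix q i assume q: "q < 2 * n div (r * s)" and i: "i < r"
  have "Suc (q * r + i) * s \<le> Suc q * r * s"
    using i by (intro mult_le_mono1) simp
  also have "\<dots> \<le> 2 * n div (r * s) * r * s"
    using q by (intro mult_le_mono1) simp
  also have "\<dots> \<le> 2 * n" by (metis div_times_less_eq_dividend mult.assoc)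
  finally show "block r s q i \<subseteq> {1..2 * n}" by (auto simp: block_def)
next
  fix q i j assume "q < 2 * n div (r * s)" "i < r" "j < r" "i \<noteq> j"
  then consider "q * r + i < q * r + j" | "q * r + j < q * r + i" by linarith
  then have "x \<notin> block r s q j" if "x \<in> block r s q i" for x
    using block_less that by cases blast+
  then show "block r s q i \<inter> block r s q j = {}" by blast
next
  fix q q' i j u v
  assume "q < q'" "q' < 2 * n div (r * s)" "i < r" "j < r" "u \<in> block r s q i" "v \<in> block r s q' j"
  then show "u < v" using block_less[OF index_less] by blast
qed (use assms in \<open>auto simp: block_def\<close>)

text \<open>It suffices to take the first block from the lower half and the second from the upper
  half.\<close>

lemma (in block_grid) card_block_pairs_ge: "(N div 2)\<^sup>2 \<le> card block_pairs"
proof -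
  have "(N div 2) * (N div 2) \<le> (N div 2) * (N - N div 2)"
    by (intro mult_le_mono2) linarith
  also have "\<dots> = card ({..<N div 2} \<times> {N div 2..<N})" by (simp add: card_cartesian_product)
  also have "\<dots> \<le> card block_pairs"
    using finite_block_pairs by (intro card_mono) (auto simp: block_pairs_def)
  finally show ?thesis by (simp add: power2_eq_square)
qed

text \<open>In \<open>c\<close>, the factor 8 r^2 2^r combines 4 r^2 from the number of block pairs
  with 2 * 2^r from the mean, and 4^(2r - 2) comes from the lower bound x^(r - 1) / 4 on the part
  size \<open>s\<close>.\<close>

lemma card_max_twins_small_le:
  fixes x :: real
  assumes r: "r \<ge> 2" and x: "x \<ge> 4" "x \<ge> real r" and n: "real n = x ^ (2 * r - 1)"
  defines "c \<equiv> 1 / (8 * real r ^ 2 * 2 ^ r * 4 ^ (2 * r - 2))"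
  shows "card {M \<in> perfect_matchings n {1..2 * n}. max_twins r M < c * x ^ r / 2}
     \<le> 16 / (c\<^sup>2 * x) * num_matchings n"
proof -
  obtain q where q: "r = Suc q" "q \<ge> 1" using r by (cases r) auto
  have c: "c > 0" using r by (simp add: c_def)
  have r_q: "2 * r - 1 = Suc (q * 2)" "2 * r - 1 = q + r" using q by simp_all
  have n': "real n = x * (x ^ q)\<^sup>2" "real n = x ^ q * x ^ r"
    unfolding n by (simp only: r_q(1) power_Suc power_mult) (simp only: r_q(2) power_add)
  have n_q: "real n = x ^ (2 * q + 1)" using n q by simp
  have n0: "real n > 0" using n x by simp
  \<comment> \<open>Halving x^q yields r s^2 \<le> n / 4, using r \<le> x and n = x * x^(2q);
    rounding down loses at most another factor 2 because x^q \<ge> 4.\<close>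
  define s where "s = nat \<lfloor>x ^ q / 2\<rfloor>"
  have xq: "x ^ q \<ge> x" using q(2) x by (intro self_le_power) auto
  have s_floor: "real s = of_int \<lfloor>x ^ q / 2\<rfloor>" using x by (simp add: s_def)
  have s_le: "real s \<le> x ^ q / 2" unfolding s_floor by linarith
  have s_ge: "real s \<ge> x ^ q / 4"
  proof -
    have "real s > x ^ q / 2 - 1" unfolding s_floor by linarith
    then show ?thesis using xq x by linarith
  qed
  have s0: "real s > 0" using s_ge xq x by linarith
  interpret block_grid "block r s" "2 * n div (r * s)" r s n "{1..2 * n}"
    using r by (intro block_grid_block) auto
  define N where "N = 2 * n div (r * s)"
  have "real (4 * r) \<le> x * x" using x by (simp add: mult_mono)
  also have "\<dots> \<le> real n"
    using xq x n'(1) mult_mono[of x "x ^ q" 1 "x ^ q"] by (auto simp: power2_eq_square)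
  finally have n4: "n \<ge> 4 * r" by linarith
  have sparse1: "real r * real s ^ 2 / n \<le> 1 / 4"
  proof -
    have "real r * real s ^ 2 \<le> x * (x ^ q / 2) ^ 2"
      using x s_le by (intro mult_mono power_mono) auto
    also have "\<dots> = real n / 4" by (simp add: n'(1) power_divide)
    finally show ?thesis using n0 by (simp add: field_simps)
  qed
  \<comment> \<open>The blocks occupy at most 2n vertices and r \<ge> 2, so N s \<le> n. The
    remaining s^(2q + 1) is at most n^q / 2^(2q + 1).\<close>
  have sparse2: "2 * real N * real s ^ (2 * r) / real n ^ r \<le> 1 / 4"
  proof -
    have "N * (r * s) \<le> 2 * n" unfolding N_def by (rule div_times_less_eq_dividend)
    then have "real N * (real r * real s) \<le> 2 * real n"
      using of_nat_mono[of "N * (r * s)" "2 * n", where 'a = real] by simp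
    moreover have "real N * (2 * real s) \<le> real N * (real r * real s)"
      using r by (intro mult_left_mono mult_right_mono) auto
    ultimately have "real N * real s \<le> real n" by linarith
    then have "2 * (real N * real s) * real s ^ (2 * q + 1) \<le> 2 * real n * (x ^ q / 2) ^ (2 * q + 1)"
      using s_le n0 by (intro mult_mono power_mono) auto
    also have "(x ^ q / 2) ^ (2 * q + 1) = real n ^ q / 2 ^ (2 * q + 1)"
      by (simp only: power_divide n_q power_mult[symmetric] mult.commute)
    also have "2 * real n * (real n ^ q / 2 ^ (2 * q + 1)) = real n ^ r / 2 ^ (2 * q)"
      by (simp add: q)
    also have "\<dots> \<le> real n ^ r / 2 ^ 2"
      using q(2) n0 by (intro divide_left_mono power_increasing) auto
    also have "2 * (real N * real s) * real s ^ (2 * q + 1) = 2 * real N * real s ^ (2 * r)"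
      by (simp add: q)
    finally show ?thesis using n0 by (simp add: field_simps)
  qed
  \<comment> \<open>\<open>N div 2\<close> is the integer part of n / (r s), a number at least 2, so
    rounding down loses at most half.\<close>
  have N2: "real (N div 2) \<ge> real n / (2 * real r * real s)"
  proof -
    have "real r * real s \<le> x * (x ^ q / 2)" using x s_le by (intro mult_mono) auto
    also have "\<dots> = x ^ r / 2" by (simp add: q)
    finally have "2 * real r * real s \<le> x ^ r" by simp
    also have "\<dots> \<le> real n"
      using n'(2) mult_mono[of 1 "x ^ q" "x ^ r" "x ^ r"] xq x by simp
    finally have ge1: "real n / (real r * real s) \<ge> 2" using s0 r by (simp add: field_simps)
    have "N div 2 = n div (r * s)"
    proof -
      have "N div 2 = 2 * n div (2 * (r * s))"
        unfolding N_def by (simp only: div_mult2_eq[symmetric] mult.commute[of "r * s"])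
      then show ?thesis by simp
    qed
    then have "real (N div 2) > real n / real (r * s) - 1"
    proof -
      have rs: "r * s > 0" using r s0 by simp
      then have "n < (N div 2) * (r * s) + r * s"
        unfolding \<open>N div 2 = n div (r * s)\<close>
        using dividend_less_div_times[of "r * s" n] by (simp only: add.commute)
      then have "real n < (real (N div 2) + 1) * real (r * s)"
        using of_nat_less_iff[of n "(N div 2) * (r * s) + r * s", where 'a = real]
        by (simp add: algebra_simps)
      then have "real n / real (r * s) < real (N div 2) + 1"
        using rs by (simp only: pos_divide_less_eq of_nat_0_less_iff)
      then show ?thesis by linarith
    qed
    then show ?thesis using ge1 by simp
  qed
  have E: "c * x ^ r \<le> real (card block_pairs) * real s ^ (2 * r) / (2 * (2 * real n) ^ r)"
  proof -
    have "(real n / (2 * real r * real s))\<^sup>2 \<le> (real (N div 2))\<^sup>2"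
      using N2 s0 by (intro power_mono) auto
    also have "\<dots> = real ((N div 2)\<^sup>2)" by simp
    also have "\<dots> \<le> real (card block_pairs)"
      using card_block_pairs_ge unfolding N_def by (rule of_nat_mono)
    finally have bp: "(real n / (2 * real r * real s))\<^sup>2 \<le> real (card block_pairs)" .
    \<comment> \<open>As powers of \<open>x\<close>, this balance of exponents says that n^2 s^(2r -
      2) / n^r has order x^r when \<open>s\<close> has order x^q.\<close>
    have exps: "x ^ r * real n ^ r = real n ^ 2 * (x ^ q) ^ (2 * q)"
    proof -
      have "r + (2 * q + 1) * r = (2 * q + 1) * 2 + q * (2 * q)" by (simp add: q algebra_simps)
      then show ?thesis unfolding n_q by (simp only: power_mult[symmetric] power_add[symmetric])
    qed
    have "c * x ^ r = real n ^ 2 * (x ^ q / 4) ^ (2 * q) / (8 * real r ^ 2 * 2 ^ r * real n ^ r)"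
    proof -
      have "c * x ^ r = x ^ r * real n ^ r / (4 ^ (2 * q) * 8 * real r ^ 2 * 2 ^ r * real n ^ r)"
        using n0 by (simp add: c_def q)
      then show ?thesis unfolding exps by (simp add: power_divide mult_ac)
    qed
    also have "\<dots> \<le> real n ^ 2 * real s ^ (2 * q) / (8 * real r ^ 2 * 2 ^ r * real n ^ r)"
      using s_ge x by (intro divide_right_mono mult_left_mono power_mono) auto
    also have "\<dots> = (real n / (2 * real r * real s))\<^sup>2 * real s ^ (2 * r) / (2 * (2 * real n) ^ r)"
      using s0 by (simp add: q power_divide power_mult_distrib power2_eq_square)
         (simp add: algebra_simps)
    also have "\<dots> \<le> real (card block_pairs) * real s ^ (2 * r) / (2 * (2 * real n) ^ r)"
      using bp by (intro divide_right_mono mult_right_mono) auto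
    finally show ?thesis .
  qed
  have "card {M \<in> perfect_matchings n {1..2 * n}. max_twins r M < c * x ^ r / 2}
      \<le> 16 * n / (c * x ^ r)\<^sup>2 * num_matchings n"
  proof (rule card_max_packed_small_le[OF n4 _ _ E])
    show "real r * real s ^ 2 / n + 2 * real (2 * n div (r * s)) * real s ^ (2 * r) / real n ^ r \<le> 1 / 2"
      using sparse1 sparse2 unfolding N_def by linarith
  qed (use c x in simp)
  \<comment> \<open>Since x^(2r) = x n, a variance of order \<open>n\<close> is smaller than the
    squared mean by a factor of order \<open>x\<close>.\<close>
  also have "16 * n / (c * x ^ r)\<^sup>2 = 16 / (c\<^sup>2 * x)"
  proof -
    have "(x ^ r)\<^sup>2 = x * real n" by (simp add: n'(1) q power2_eq_square)
    then show ?thesis using n0 by (simp add: power_mult_distrib)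
  qed
  finally show ?thesis .
qed

text \<open>The threshold \<open>K\<close> rounds C x^r up. As C \<ge> 1 and (x^r)^(2r - 1) = n^r,
  one gets C n^r \<le> K^(2r - 1), the largeness that the first moment bound requires.\<close>

lemma card_max_twins_large_le:
  fixes x :: real
  assumes r: "r \<ge> 1" and x: "x \<ge> 1" and n: "real n = x ^ (2 * r - 1)"
  shows "card {M \<in> perfect_matchings n {1..2 * n}. 4 * exp 1 ^ (3 * r - 1) * x ^ r < max_twins r M}
     \<le> 2 / x * num_matchings n"
proof -
  define C where "C = 4 * exp (1 :: real) ^ (3 * r - 1)"
  have C: "C \<ge> 1"
  proof -
    have "exp (1 :: real) ^ (3 * r - 1) \<ge> 1" by (rule one_le_power) simp
    then show ?thesis unfolding C_def by linarith
  qed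
  define K where "K = nat \<lceil>C * x ^ r\<rceil>"
  have K: "C * x ^ r \<le> real K" unfolding K_def by (rule real_nat_ceiling_ge)
  have xK: "x \<le> real K"
    using K mult_mono[of 1 C x "x ^ r"] self_le_power[of x r] C x r by auto
  then have K0: "K > 0" using x by (cases K) auto
  have "C * real n ^ r \<le> C ^ (2 * r - 1) * real n ^ r"
    using C r self_le_power[of C "2 * r - 1"] by (intro mult_right_mono) auto
  also have "\<dots> = (C * x ^ r) ^ (2 * r - 1)"
    by (simp add: n power_mult_distrib power_mult[symmetric] mult.commute)
  also have "\<dots> \<le> real K ^ (2 * r - 1)" using K C x by (intro power_mono) auto
  finally have "4 * exp 1 ^ (3 * r - 1) * real n ^ r \<le> real K ^ (2 * r - 1)" by (simp add: C_def)
  from card_max_twins_ge_le[OF _ _ r K0 this, of "{1..2 * n}"]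
  have "card {M \<in> perfect_matchings n {1..2 * n}. K \<le> max_twins r M} \<le> 2 * (1 / 2) ^ K * num_matchings n"
    by simp
  \<comment> \<open>The exponentially small bound is weakened through x \<le> K < 2^K to match the 1
    / x rate of the lower tail.\<close>
  also have "\<dots> \<le> 2 / x * num_matchings n"
  proof (rule mult_right_mono)
    have "real K < 2 ^ K" by (rule of_nat_less_two_power)
    with xK have "x \<le> 2 ^ K" by linarith
    then show "2 * (1 / 2) ^ K \<le> 2 / x" using x by (simp add: field_simps power_one_over)
  qed simp
  finally have *: "card {M \<in> perfect_matchings n {1..2 * n}. K \<le> max_twins r M} \<le> 2 / x * num_matchings n" .
  have "card {M \<in> perfect_matchings n {1..2 * n}. C * x ^ r < max_twins r M}
      \<le> card {M \<in> perfect_matchings n {1..2 * n}. K \<le> max_twins r M}"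
    by (intro card_mono) (auto simp: K_def finite_perfect_matchings ceiling_le_iff nat_le_iff)
  then show ?thesis using * unfolding C_def by linarith
qed

section \<open>Both tails combined\<close>

lemma prob_max_twins_between_ge:
  fixes x :: real
  assumes r: "r \<ge> 2" and x: "x \<ge> 4" "x \<ge> real r" and n: "real n = x ^ (2 * r - 1)"
  defines "c \<equiv> 1 / (8 * real r ^ 2 * 2 ^ r * 4 ^ (2 * r - 2))" and "C \<equiv> 4 * exp 1 ^ (3 * r - 1)"
  shows "measure_pmf.prob (random_matching n)
       {M. c / 2 * x ^ r \<le> max_twins r M \<and> max_twins r M \<le> C * x ^ r} \<ge> 1 - (16 / c\<^sup>2 + 2) / x"
proof -
  let ?P = "perfect_matchings n {1..2 * n}"
  let ?A = "{M. c / 2 * x ^ r \<le> max_twins r M \<and> max_twins r M \<le> C * x ^ r}"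
  let ?L = "{M \<in> ?P. max_twins r M < c * x ^ r / 2}"
  let ?U = "{M \<in> ?P. C * x ^ r < max_twins r M}"
  have fin: "finite ?P" by (simp add: finite_perfect_matchings)
  have m: "card ?P = num_matchings n" by (simp add: card_perfect_matchings)
  have m0: "real (num_matchings n) > 0" using num_matchings_pos by simp
  have "?P - ?A \<subseteq> ?L \<union> ?U" by auto
  then have "card (?P - ?A) \<le> card (?L \<union> ?U)" using fin by (intro card_mono) auto
  also have "\<dots> \<le> card ?L + card ?U" by (rule card_Un_le)
  finally have "real (card (?P - ?A)) \<le> real (card ?L) + real (card ?U)" by linarith
  also have "\<dots> \<le> 16 / (c\<^sup>2 * x) * num_matchings n + 2 / x * num_matchings n"
    unfolding c_def C_def
    using card_max_twins_small_le[OF r x n] card_max_twins_large_le[of r x n] r x n by (intro add_mono) auto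
  also have "\<dots> = (16 / c\<^sup>2 + 2) / x * num_matchings n"
    by (simp add: add_divide_distrib distrib_right)
  finally have bad: "real (card (?P - ?A)) \<le> (16 / c\<^sup>2 + 2) / x * num_matchings n" .
  have "card ?P = card (?P \<inter> ?A) + card (?P - ?A)"
    using fin by (rule card_Int_Diff)
  then have "real (card (?P \<inter> ?A)) = num_matchings n - real (card (?P - ?A))" using m by linarith
  then have "real (card (?P \<inter> ?A)) \<ge> (1 - (16 / c\<^sup>2 + 2) / x) * num_matchings n"
    using bad by (simp add: algebra_simps)
  moreover have "measure_pmf.prob (random_matching n) ?A = real (card (?P \<inter> ?A)) / num_matchings n"
    unfolding random_matching_def
    by (subst measure_pmf_of_set[OF matchings_nonempty finite_matchings]) (simp only: matchings_def m)
  ultimately show ?thesis using m0 by (simp only: le_divide_eq) simp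
qed

theorem theorem20:
  fixes r :: nat
  assumes "r \<ge> 2"
  shows "\<exists>c C :: real. c > 0 \<and> C > 0 \<and>
    ((\<lambda>n. measure_pmf.prob (random_matching n)
       {M. c * real n powr (real r / (2 * real r - 1)) \<le> real (max_twins r M) \<and>
           real (max_twins r M) \<le> C * real n powr (real r / (2 * real r - 1))})
     \<longlonglongrightarrow> 1)"
proof -
  define c where "c = 1 / (8 * real r ^ 2 * 2 ^ r * 4 ^ (2 * r - 2))"
  define C where "C = 4 * exp (1 :: real) ^ (3 * r - 1)"
  \<comment> \<open>With x = n^a one has n = x^(2r - 1) and n^(r / (2r - 1)) = x^r, so the finite
    estimates apply once \<open>x\<close> is large, and their error of order 1 / x vanishes.\<close>
  define a where "a = 1 / (2 * real r - 1)"
  have a: "a > 0" using assms by (simp add: a_def)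
  define x where "x n = real n powr a" for n :: nat
  define p where "p n = measure_pmf.prob (random_matching n)
       {M. c / 2 * real n powr (real r / (2 * real r - 1)) \<le> real (max_twins r M) \<and>
           real (max_twins r M) \<le> C * real n powr (real r / (2 * real r - 1))}" for n
  have x_lim: "filterlim x at_top sequentially"
    unfolding x_def using a by real_asymp
  have "eventually (\<lambda>n. 1 - (16 / c\<^sup>2 + 2) / x n \<le> p n) sequentially"
  proof -
    have "eventually (\<lambda>n. x n \<ge> max 4 (real r)) sequentially"
      using x_lim[unfolded filterlim_at_top] by blast
    moreover have "eventually (\<lambda>n :: nat. n > 0) sequentially" by (rule eventually_gt_at_top)
    ultimately show ?thesis
    proof eventually_elim
      case (elim n)
      \<comment> \<open>Positivity of \<open>n\<close> is what identifies natural powers of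
        \<open>x n\<close> with real powers of \<open>n\<close>.\<close>
      have pw: "x n ^ k = real n powr (a * real k)" for k
        using elim(2) by (simp add: x_def powr_powr[symmetric] powr_realpow)
      have "a * real (2 * r - 1) = 1" using assms by (simp add: a_def of_nat_diff)
      then have "real n = x n ^ (2 * r - 1)" using elim(2) by (simp only: pw powr_one)
      moreover have "real n powr (real r / (2 * real r - 1)) = x n ^ r"
        unfolding pw by (simp add: a_def)
      ultimately show ?case
        unfolding p_def c_def C_def using prob_max_twins_between_ge[OF assms, of "x n" n] elim(1) by simp
    qed
  qed
  moreover have "eventually (\<lambda>n. p n \<le> 1) sequentially"
    unfolding p_def by (intro always_eventually allI measure_pmf.prob_le_1)
  moreover have "(\<lambda>n. 1 - (16 / c\<^sup>2 + 2) / x n) \<longlonglongrightarrow> 1 - 0"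
    by (intro tendsto_diff tendsto_const real_tendsto_divide_at_top[OF tendsto_const x_lim])
  ultimately have "p \<longlonglongrightarrow> 1"
    using tendsto_sandwich[of "\<lambda>n. 1 - (16 / c\<^sup>2 + 2) / x n" p sequentially "\<lambda>_. 1" 1] by simp
  moreover have "c / 2 > 0" "C > 0" using assms by (simp_all add: c_def C_def)
  ultimately show ?thesis unfolding p_def by blast
qed

end
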